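(* Let $z^{(n)}$ ($z\in V(\Lambda)$, $n=0,1,2,\dots$) be the Taylor coefficients in the expansion $$e_t(z)=\sum_{n=0}^\infty t^nz^{(n)},\qquad |t|<1,\ z\in V(\Lambda).$$ Then each $z^{(n)}$ is a DA function of $z$, and the following hold: 1. $z^{(0)}=1$ and $z^{(n)}=Z_+z^{(n-1)}$ for all $n\in\mathbb{N}$; in particular, $z^{(1)}=z$. 2. $Z_-z^{(0)}=0$ and $Z_-z^{(n)}=z^{(n-1)}$ for all $n\in\mathbb{N}$. 3. $\limsup_{n\to\infty}\sqrt[n]{|z^{(n)}|}\le 1$ for every $z\in V(\Lambda)$. Moreover, $z^{(0)},z^{(1)},z^{(2)},\dots$ form a linearly independent family of vectors in $\mathcal{H}(\Lambda)$.
   Context: **Lattice.** $\Lambda$ is a rhombic lattice in the complex plane $\mathbb{C}$: a monohedral (all tiles congruent), edge-to-edge tessellation of $\mathbb{C}$ with rhombi of side length $1$. $V(\Lambda)$, $E(\Lambda)$ denote its sets of vertices and edges; $(a,b)\in E(\Lambda)$ means that $a,b\in V(\Lambda)$ are adjacent, and edges are taken in both orientations, so $(a,b)\in E(\Lambda)$ iff $(b,a)\in E(\Lambda)$. A path in $\Lambda$ from $a$ to $b$ is a finite sequence $(z_0,\dots,z_N)$ of vertices with $z_0=a$, $z_N=b$ and $z_{n-1},z_n$ adjacent for $n=1,\dots,N$; it is closed if $a=b$. Standing assumptions on $\Lambda$: (i) $0\in V(\Lambda)$; (ii) for every $z\in V(\Lambda)$ there are $N\in\mathbb{N}$ and a path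 $(z_0,\dots,z_N)$ with $z_0=z$, $z_n-z_{n-1}\neq\pm1$ for $n=1,\dots,N-1$, and $z_N-z_{N-1}=1$. **Discrete analyticity.** For $f:V(\Lambda)\to\mathbb{C}$ and a path $\gamma=(z_0,\dots,z_N)$, $\int_\gamma f\,\delta z=\sum_{n=1}^N\frac{f(z_{n-1})+f(z_n)}{2}(z_n-z_{n-1})$. $f$ is discrete analytic (DA) if $\int_\gamma f\,\delta z=0$ for every closed path $\gamma$; then $\int_a^b f\,\delta z$ denotes $\int_\gamma f\,\delta z$ for any path $\gamma$ from $a$ to $b$. $\mathcal{H}(\Lambda)$ is the complex vector space of DA functions on $V(\Lambda)$. **Shift operators.** $Z_+:\mathcal{H}(\Lambda)\to\mathcal{H}(\Lambda)$ is $(Z_+f)(z)=\frac{f(0)-f(z)}{2}+\int_0^z f\,\delta z$. It is injective with range $\{g\in\mathcal{H}(\Lambda):g(0)=0\}$, so one may define $Z_-:\mathcal{H}(\Lambda)\to\mathcal{H}(\Lambda)$ by letting $Z_-f$ be the unique element of $\mathcal{H}(\Lambda)$ with $(Z_+Z_-f)(z)=f(z)-f(0)$. **The set $S(\Lambda)$ and the functions $e_t$.** $S(\Lambda)=\{t\in\mathbb{C}: t(1+b-a)=-2\text{ for some }(a,b)\in E(\Lambda)\}$; it is a finite set contained in the complement of the open unit disk. Standing assumption: no element of $S(\Lambda)$ is an eigenvalue of $Z_-$ on $\mathcal{H}(\Lambda)$. For $t\in\mathbb{C}\setminus S(\Lambda)$, $e_t:V(\Lambda)\to\mathbb{C}$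 is given by $e_t(0)=1$ and $e_t(z)=\prod_{k=1}^N\frac{2+t(1+z_k-z_{k-1})}{2+t(1+z_{k-1}-z_k)}$ for $z\ne0$, where $(z_0,\dots,z_N)$ is any path in $\Lambda$ from $0$ to $z$ (the value does not depend on the path, and $e_t$ is DA with $Z_-e_t=te_t$). For fixed $z$, $e_t(z)$ is a rational function of $t$, analytic in $|t|<1$. *)

theory Defs
  imports "HOL-Analysis.Analysis" "HOL-Library.Function_Algebras"
begin

text \<open>A lattice is represented by the set of its (closed, two-dimensional) tiles.\<close>

definition unit_rhombus :: "complex set \<Rightarrow> bool" where
  "unit_rhombus R \<longleftrightarrow>
     (\<exists>p u v. norm u = 1 \<and> norm v = 1 \<and> u \<noteq> v \<and> u \<noteq> - v \<and>
        R = convex hull {p, p + u, p + u + v, p + v})"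

definition congruent_sets :: "complex set \<Rightarrow> complex set \<Rightarrow> bool" where
  "congruent_sets A B \<longleftrightarrow>
     (\<exists>\<phi>::complex \<Rightarrow> complex. (\<forall>x y. dist (\<phi> x) (\<phi> y) = dist x y) \<and> \<phi> ` A = B)"

text \<open>The last conjunct is the edge-to-edge condition: two tiles meet in a common face
  (the empty set, a vertex, an edge, or, for equal tiles, the whole tile).\<close>

definition rhombic_lattice :: "complex set set \<Rightarrow> bool" where
  "rhombic_lattice \<Lambda> \<longleftrightarrow>
     (\<forall>R\<in>\<Lambda>. unit_rhombus R) \<and>
     (\<forall>R\<in>\<Lambda>. \<forall>R'\<in>\<Lambda>. congruent_sets R R') \<and>
     \<Union>\<Lambda> = UNIV \<and>
     (\<forall>R\<in>\<Lambda>. \<forall>R'\<in>\<Lambda>. R \<noteq> R' \<longrightarrow> interior R \<inter> interior R' = {}) \<and>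
     (\<forall>R\<in>\<Lambda>. \<forall>R'\<in>\<Lambda>. (R \<inter> R') face_of R \<and> (R \<inter> R') face_of R')"

definition vertices :: "complex set set \<Rightarrow> complex set" where
  "vertices \<Lambda> = {z. \<exists>R\<in>\<Lambda>. z extreme_point_of R}"

definition edges :: "complex set set \<Rightarrow> (complex \<times> complex) set" where
  "edges \<Lambda> = {(a, b). \<exists>R\<in>\<Lambda>. closed_segment a b edge_of R}"

text \<open>A path \<open>(z\<^sub>0, \<dots>, z\<^sub>N)\<close> is a list of length \<open>N + 1\<close>.\<close>

definition lattice_path :: "complex set set \<Rightarrow> complex \<Rightarrow> complex \<Rightarrow> complex list \<Rightarrow> bool" where
  "lattice_path \<Lambda> a b zs \<longleftrightarrow>
     zs \<noteq> [] \<and> set zs \<subseteq> vertices \<Lambda> \<and> hd zs = a \<and> last zs = b \<and>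
     (\<forall>n\<in>{1..<length zs}. (zs ! (n - 1), zs ! n) \<in> edges \<Lambda>)"

definition path_to_one_step :: "complex set set \<Rightarrow> bool" where
  "path_to_one_step \<Lambda> \<longleftrightarrow>
     (\<forall>z\<in>vertices \<Lambda>. \<exists>zs w. lattice_path \<Lambda> z w zs \<and> length zs \<ge> 2 \<and>
        (\<forall>n\<in>{1..<length zs - 1}. zs ! n - zs ! (n - 1) \<notin> {1, -1}) \<and>
        zs ! (length zs - 1) - zs ! (length zs - 2) = 1)"

definition path_integral :: "(complex \<Rightarrow> complex) \<Rightarrow> complex list \<Rightarrow> complex" where
  "path_integral f zs =
     (\<Sum>n\<in>{1..<length zs}. (f (zs ! (n - 1)) + f (zs ! n)) / 2 * (zs ! n - zs ! (n - 1)))"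

text \<open>A function on the vertices is represented by the function on the complex plane that
  extends it by \<open>0\<close>, so that pointwise operations and equality of functions on the
  vertices are those of the ambient function space.\<close>

definition DA :: "complex set set \<Rightarrow> (complex \<Rightarrow> complex) set" where
  "DA \<Lambda> = {f. (\<forall>z. z \<notin> vertices \<Lambda> \<longrightarrow> f z = 0) \<and>
                (\<forall>a zs. lattice_path \<Lambda> a a zs \<longrightarrow> path_integral f zs = 0)}"

text \<open>For discrete analytic \<open>f\<close> the value does not depend on the path chosen here.\<close>

definition lattice_integral :: "complex set set \<Rightarrow> complex \<Rightarrow> complex \<Rightarrow> (complex \<Rightarrow> complex) \<Rightarrow> complex" where
  "lattice_integral \<Lambda> a b f = path_integral f (SOME zs. lattice_path \<Lambda> a b zs)"

definition Z_plus :: "complex set set \<Rightarrow> (complex \<Rightarrow> complex) \<Rightarrow> complex \<Rightarrow> complex" where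
  "Z_plus \<Lambda> f z =
     (if z \<in> vertices \<Lambda> then (f 0 - f z) / 2 + lattice_integral \<Lambda> 0 z f else 0)"

definition Z_minus :: "complex set set \<Rightarrow> (complex \<Rightarrow> complex) \<Rightarrow> complex \<Rightarrow> complex" where
  "Z_minus \<Lambda> f = (THE g. g \<in> DA \<Lambda> \<and> (\<forall>z\<in>vertices \<Lambda>. Z_plus \<Lambda> g z = f z - f 0))"

definition eigenvalue_Z_minus :: "complex set set \<Rightarrow> complex \<Rightarrow> bool" where
  "eigenvalue_Z_minus \<Lambda> t \<longleftrightarrow>
     (\<exists>f\<in>DA \<Lambda>. f \<noteq> (\<lambda>z. 0) \<and> Z_minus \<Lambda> f = (\<lambda>z. t * f z))"

definition S_set :: "complex set set \<Rightarrow> complex set" where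
  "S_set \<Lambda> = {t. \<exists>(a, b)\<in>edges \<Lambda>. t * (1 + b - a) = -2}"

text \<open>The product is independent of the path chosen here. Only parameters
  \<open>t \<notin> S_set \<Lambda>\<close>, for which no denominator vanishes, are meaningful.\<close>

definition e_fun :: "complex set set \<Rightarrow> complex \<Rightarrow> complex \<Rightarrow> complex" where
  "e_fun \<Lambda> t z =
     (if z \<notin> vertices \<Lambda> then 0
      else if z = 0 then 1
      else (let zs = (SOME zs. lattice_path \<Lambda> 0 z zs) in
        \<Prod>k\<in>{1..<length zs}.
          (2 + t * (1 + zs ! k - zs ! (k - 1))) / (2 + t * (1 + zs ! (k - 1) - zs ! k))))"

definition z_power :: "complex set set \<Rightarrow> nat \<Rightarrow> complex \<Rightarrow> complex" where
  "z_power \<Lambda> n z = (deriv ^^ n) (\<lambda>t. e_fun \<Lambda> t z) 0 / fact n"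

interpretation cfun: vector_space "\<lambda>(c::complex) (f::complex \<Rightarrow> complex) z. c * f z"
  by unfold_locales (auto simp: fun_eq_iff algebra_simps)

text \<open>Linear independence of a family, as opposed to a set: repetitions are excluded.\<close>

definition independent_family :: "('i \<Rightarrow> complex \<Rightarrow> complex) \<Rightarrow> bool" where
  "independent_family v \<longleftrightarrow> inj v \<and> cfun.independent (range v)"

end

theory Submission
  imports Defs "HOL-Complex_Analysis.Complex_Analysis"
begin

text \<open>Along an edge with \<open>d = b - a\<close> the function \<open>e\<^sub>t\<close> satisfies
  \<open>e\<^sub>t(b) (2 + t (1 - d)) = e\<^sub>t(a) (2 + t (1 + d))\<close>. Comparing the coefficients of \<open>t\<^bsup>n+1\<^esup>\<close> shows that the
  trapezoidal integral of \<open>z\<^bsup>(n)\<^esup>\<close> along the edge is the increment of \<open>z\<^bsup>(n+1)\<^esup> + z\<^bsup>(n)\<^esup> / 2\<close>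
  (\<open>z_power_edge\<close>). Integrals of \<open>z\<^bsup>(n)\<^esup>\<close> therefore telescope: \<open>z\<^bsup>(n)\<^esup>\<close> is discrete analytic and
  \<open>Z\<^sub>+ z\<^bsup>(n)\<^esup> = z\<^bsup>(n+1)\<^esup>\<close>. The operator \<open>Z\<^sub>+\<close> is injective because every vertex is joined to a step \<open>1\<close> by
  steps other than \<open>\<plusminus>1\<close> (\<open>Z_plus_injective\<close>); this gives the statements on \<open>Z\<^sub>-\<close>, and linear independence
  follows by lowering the indices of a relation. The bound on the growth of \<open>z\<^bsup>(n)\<^esup>\<close> is convergence of
  the Taylor series in the unit disc.

  All of this presupposes that \<open>e\<^sub>t\<close> is well defined, that is, that vertices are joined by paths and that
  the product does not depend on the path. For \<open>\<bar>t\<bar> < 1\<close> the product is the exponential of a sum of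
  \<open>l (d)\<close> over the steps \<open>d\<close>, where \<open>l\<close> is an odd function of unit vectors. On one rhombus with sides \<open>u\<close>
  and \<open>v\<close> there is a real-linear form with values \<open>l u\<close> and \<open>l v\<close>; these forms agree along common
  edges, so together they are a closed form that is constant on tiles. Its potentials exist locally,
  are unique up to constants on connected sets, and hence can be glued over arbitrarily large boxes
  (\<open>potential_on_cbox\<close>). The increments of such a potential along edges are the numbers \<open>l (d)\<close>, so
  the sum over a path depends only on its end points. Local finiteness of the tiling, used throughout,
  follows from congruence of the tiles.\<close>

section \<open>Faces of a rhombus\<close>

lemma unit_vectors_not_parallel:
  fixes u v :: complex
  assumes "norm u = 1" "norm v = 1" "u \<noteq> v" "u \<noteq> - v"
  shows "u \<noteq> of_real r * v"
proof
  assume u: "u = of_real r * v"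
  then have "\<bar>r\<bar> = 1" using assms by (simp add: norm_mult)
  then have "r = 1 \<or> r = -1" by linarith
  then show False using u assms by auto
qed

lemma unit_vectors_Im_nonzero:
  fixes u v :: complex
  assumes "norm u = 1" "norm v = 1" "u \<noteq> v" "u \<noteq> - v"
  shows "Im (u * cnj v) \<noteq> 0"
proof
  assume "Im (u * cnj v) = 0"
  then have "u * cnj v = of_real (Re (u * cnj v))" by (simp add: complex_eq_iff)
  then have "u * (v * cnj v) = of_real (Re (u * cnj v)) * v" by (metis mult.assoc mult.commute)
  moreover have "v * cnj v = 1" using assms complex_norm_square[of v] by simp
  ultimately show False using unit_vectors_not_parallel[OF assms] by (metis mult.right_neutral)
qed

lemma affine_hull_pair_complex:
  fixes p u :: complex
  assumes "w \<in> affine hull {p, p + u}"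
  obtains y where "w = p + of_real y * u"
proof -
  obtain c d where "w = c *\<^sub>R p + d *\<^sub>R (p + u)" "c + d = 1"
    using assms by (auto simp: affine_hull_2)
  moreover from this have "c = 1 - d" by linarith
  ultimately have "w = p + of_real d * u" by (simp add: algebra_simps scaleR_conv_of_real)
  then show ?thesis by (rule that)
qed

lemma rhombus_side_edge:
  fixes u v :: complex
  assumes uv: "norm u = 1" "norm v = 1" "u \<noteq> v" "u \<noteq> - v"
  shows "closed_segment p (p + u) edge_of (convex hull {p, p + u, p + u + v, p + v})"
proof -
  let ?S = "{p, p + u, p + u + v, p + v}"
  have np: "v \<noteq> of_real r * u" for r
    using unit_vectors_not_parallel[of v u r] uv by (metis minus_minus)
  have "affine hull {p, p + u} \<inter> convex hull (?S - {p, p + u}) = {}"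
  proof (rule equals0I)
    fix w assume w: "w \<in> affine hull {p, p + u} \<inter> convex hull (?S - {p, p + u})"
    have "?S - {p, p + u} \<subseteq> {p + v, p + v + u}" by (auto simp: algebra_simps)
    then have "w \<in> convex hull {p + v, p + v + u}" using w hull_mono by blast
    then have "w \<in> affine hull {p + v, p + v + u}" using convex_hull_subset_affine_hull by blast
    then obtain y where y: "w = p + v + of_real y * u" by (rule affine_hull_pair_complex)
    obtain x where "w = p + of_real x * u" using w affine_hull_pair_complex by blast
    with y have "v = of_real (x - y) * u" by (simp add: algebra_simps)
    then show False using np by blast
  qed
  then have "(convex hull {p, p + u}) face_of (convex hull ?S)"
    by (intro face_of_convex_hulls) auto
  moreover have "aff_dim (closed_segment p (p + u)) = 1"
    using uv by (auto simp: aff_dim_convex_hull aff_dim_2 segment_convex_hull)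
  ultimately show ?thesis by (simp add: edge_of_def segment_convex_hull)
qed

text \<open>The midpoint of a diagonal lies inside the other diagonal, so a diagonal that is a face would
  contain the remaining corners.\<close>

lemma rhombus_diagonal_not_face:
  fixes u v :: complex
  assumes uv: "norm u = 1" "norm v = 1" "u \<noteq> v" "u \<noteq> - v"
  shows "\<not> closed_segment p (p + u + v) face_of (convex hull {p, p + u, p + u + v, p + v})"
proof
  let ?R = "convex hull {p, p + u, p + u + v, p + v}"
  assume f: "closed_segment p (p + u + v) face_of ?R"
  have "midpoint p (p + u + v) = midpoint (p + u) (p + v)"
    by (simp add: midpoint_def algebra_simps)
  then have "midpoint p (p + u + v) \<in> open_segment (p + u) (p + v)" using uv by simp
  moreover have "p + u \<in> ?R" "p + v \<in> ?R" by (simp_all add: hull_inc)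
  ultimately have "p + u \<in> closed_segment p (p + u + v)"
    using f unfolding face_of_def by (meson midpoint_in_closed_segment)
  then obtain s where "p + u = (1 - s) *\<^sub>R p + s *\<^sub>R (p + u + v)"
    by (auto simp: closed_segment_def)
  then have "of_real (1 - s) * u = of_real s * v"
    by (simp add: algebra_simps scaleR_conv_of_real)
  moreover from this have "\<bar>1 - s\<bar> = \<bar>s\<bar>"
    using uv by (metis mult.right_neutral norm_mult norm_of_real)
  then have "s = 1/2" by linarith
  ultimately show False using uv by simp
qed

lemma rhombus_edge_direction:
  fixes u v :: complex
  assumes uv: "norm u = 1" "norm v = 1" "u \<noteq> v" "u \<noteq> - v"
    and e: "closed_segment a b edge_of (convex hull {p, p + u, p + u + v, p + v})"
  shows "b - a \<in> {u, - u, v, - v}"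
proof -
  let ?S = "{p, p + u, p + u + v, p + v}"
  have f: "closed_segment a b face_of (convex hull ?S)" and d: "aff_dim (closed_segment a b) = 1"
    using e by (auto simp: edge_of_def)
  have "a \<in> ?S" "b \<in> ?S"
    using extreme_point_of_face[OF f] extreme_point_of_segment extreme_point_of_convex_hull by blast+
  moreover have "a \<noteq> b" using d by auto
  moreover have "\<not> closed_segment p (p + u + v) face_of (convex hull ?S)"
    using rhombus_diagonal_not_face[OF uv] .
  moreover have "\<not> closed_segment (p + u) (p + v) face_of (convex hull ?S)"
  proof -
    have "{p + u, p + u + v, p + u + v + - u, p + u + - u} = ?S" by auto
    then show ?thesis using rhombus_diagonal_not_face[of v "- u" "p + u"] uv
      by (simp add: minus_equation_iff) (metis add.commute minus_minus)
  qed
  ultimately show ?thesis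
    using f by (auto simp: closed_segment_commute algebra_simps)
qed

text \<open>Two sides of a rhombus are a real basis of the plane, so prescribing the values \<open>l u\<close> and
  \<open>l v\<close> determines a real-linear form; oddness of \<open>l\<close> makes the prescription independent of the
  orientation of the sides.\<close>

lemma unit_rhombus_edge_form:
  fixes l :: "complex \<Rightarrow> complex"
  assumes "unit_rhombus R" and odd: "\<And>d. norm d = 1 \<Longrightarrow> l (- d) = - l d"
  obtains \<omega> where "linear \<omega>" "\<And>a b. closed_segment a b edge_of R \<Longrightarrow> \<omega> (b - a) = l (b - a)"
proof -
  obtain p u v where uv: "norm u = 1" "norm v = 1" "u \<noteq> v" "u \<noteq> - v"
    and R: "R = convex hull {p, p + u, p + u + v, p + v}"
    using assms(1) unfolding unit_rhombus_def by blast
  have "v \<noteq> - u" using uv by (metis minus_minus)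
  then have D: "Im (u * cnj v) \<noteq> 0" "Im (v * cnj u) \<noteq> 0"
    using unit_vectors_Im_nonzero uv by blast+
  define c d where "c = inverse (Im (u * cnj v))" and "d = inverse (Im (v * cnj u))"
  define \<omega> where "\<omega> w = of_real (Im (w * cnj v) * c) * l u + of_real (Im (w * cnj u) * d) * l v" for w
  have lin: "linear \<omega>"
    by (rule linearI) (simp_all add: \<omega>_def scaleR_conv_of_real algebra_simps)
  have wu: "\<omega> u = l u" using D by (simp add: \<omega>_def c_def d_def mult.commute)
  have wv: "\<omega> v = l v" using D by (simp add: \<omega>_def c_def d_def mult.commute)
  have "\<omega> (b - a) = l (b - a)" if "closed_segment a b edge_of R" for a b
    using rhombus_edge_direction[OF uv that[unfolded R]] wu wv odd uv linear_neg[OF lin] by auto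
  then show ?thesis using that lin by blast
qed

lemma unit_rhombus_edge_norm:
  assumes "unit_rhombus R" "closed_segment a b edge_of R"
  shows "norm (b - a) = 1"
  using assms rhombus_edge_direction unfolding unit_rhombus_def by fastforce

lemma unit_rhombus_compact_convex:
  assumes "unit_rhombus R"
  shows "compact R" "convex R" "R \<noteq> {}"
  using assms unfolding unit_rhombus_def by (auto simp: finite_imp_compact_convex_hull)

lemma unit_rhombus_dist_le:
  assumes "unit_rhombus R" "x \<in> R" "y \<in> R"
  shows "dist x y \<le> 4"
proof -
  obtain p u v where uv: "norm u = 1" "norm v = 1"
    and R: "R = convex hull {p, p + u, p + u + v, p + v}"
    using assms(1) unfolding unit_rhombus_def by blast
  have "norm (u + v) \<le> 2" using norm_triangle_ineq[of u v] uv by simp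
  then have "{p, p + u, p + (u + v), p + v} \<subseteq> cball p 2"
    using uv by (simp add: dist_norm norm_minus_commute add.commute)
  then have "R \<subseteq> cball p 2" unfolding R add.assoc by (rule hull_minimal) simp
  then have "dist p x \<le> 2" "dist p y \<le> 2" using assms by auto
  then show ?thesis using dist_triangle3[of x y p] by linarith
qed

lemma unit_rhombus_interior:
  assumes "unit_rhombus R"
  shows "interior R \<noteq> {}"
proof -
  obtain p u v where uv: "norm u = 1" "norm v = 1" "u \<noteq> v" "u \<noteq> - v"
    and R: "R = convex hull {p, p + u, p + u + v, p + v}"
    using assms unfolding unit_rhombus_def by blast
  have "\<not> collinear {p, p + u, p + v}"
  proof
    assume "collinear {p, p + u, p + v}"
    then have "p + v \<in> affine hull {p, p + u}"
      using collinear_3_affine_hull[of p "p + u" "p + v"] uv by fastforce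
    then obtain y where "p + v = p + of_real y * u" by (rule affine_hull_pair_complex)
    then have "v = of_real y * u" by simp
    then show False using unit_vectors_not_parallel[of v u y] uv by (metis minus_minus)
  qed
  moreover have "{p, p + u, p + v} \<subseteq> R" by (auto simp: R hull_inc)
  ultimately have "\<not> aff_dim R \<le> 1" using collinear_aff_dim collinear_subset by blast
  then have "aff_dim R = DIM(complex)" using aff_dim_le_DIM[of R] by simp
  then have "rel_interior R = interior R" using aff_dim_eq_full rel_interior_interior by blast
  then show ?thesis
    using unit_rhombus_compact_convex[OF assms] by (metis rel_interior_eq_empty)
qed

lemma rhombus_corner_cycle:
  fixes u v :: complex
  assumes uv: "norm u = 1" "norm v = 1" "u \<noteq> v" "u \<noteq> - v"
    and R: "R = convex hull {p, p + u, p + u + v, p + v}"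
  shows "closed_segment p (p + u) edge_of R" "closed_segment (p + u) (p + u + v) edge_of R"
    "closed_segment (p + u + v) (p + v) edge_of R" "closed_segment (p + v) p edge_of R"
proof -
  show "closed_segment p (p + u) edge_of R" unfolding R by (rule rhombus_side_edge[OF uv])
  \<comment> \<open>The same rhombus, described from the corner \<open>p + u\<close> by the sides \<open>v\<close> and \<open>- u\<close>, and so on.\<close>
  have "{p + u, p + u + v, p + u + v + - u, p + u + - u} = {p, p + u, p + u + v, p + v}" by auto
  then show "closed_segment (p + u) (p + u + v) edge_of R"
    using rhombus_side_edge[of v "- u" "p + u"] uv R by (metis minus_minus norm_minus_cancel)
  have "{p + u + v, p + u + v + - u, p + u + v + - u + - v, p + u + v + - v} = {p, p + u, p + u + v, p + v}" by auto
  then show "closed_segment (p + u + v) (p + v) edge_of R"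
    using rhombus_side_edge[of "- u" "- v" "p + u + v"] uv R
    by (simp add: algebra_simps) (metis minus_minus)
  have "{p + v, p + v + - v, p + v + - v + u, p + v + u} = {p, p + u, p + u + v, p + v}" by auto
  then show "closed_segment (p + v) p edge_of R"
    using rhombus_side_edge[of "- v" u "p + v"] uv R
    by (simp add: algebra_simps)
qed

lemma rhombus_proper_face_with_two_points:
  assumes R: "unit_rhombus R" and F: "F face_of R" "F \<noteq> R" and xy: "x \<in> F" "y \<in> F" "x \<noteq> y"
  obtains a b where "F = closed_segment a b" "F edge_of R"
proof -
  note C = unit_rhombus_compact_convex[OF R]
  have "aff_dim F < aff_dim R" using face_of_aff_dim_lt[OF C(2) F] .
  then have le: "aff_dim F \<le> 1" using aff_dim_le_DIM[of R] by simp
  have "aff_dim {x, y} \<le> aff_dim F" using xy by (intro aff_dim_subset) auto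
  then have "aff_dim F = 1" using le xy by simp
  then have "F edge_of R" using F by (simp add: edge_of_def)
  moreover have "compact F" "convex F" "F \<noteq> {}" "collinear F"
    using face_of_imp_compact[OF C(2,1) F(1)] face_of_imp_convex[OF F(1)] xy le
    by (auto simp: collinear_aff_dim)
  then obtain a b where "F = closed_segment a b"
    by (metis compact_convex_collinear_segment)
  ultimately show ?thesis using that by blast
qed

section \<open>Local structure of the tiling\<close>

lemma rhombic_latticeD:
  assumes "rhombic_lattice \<Lambda>"
  shows "R \<in> \<Lambda> \<Longrightarrow> unit_rhombus R"
    and "R \<in> \<Lambda> \<Longrightarrow> R' \<in> \<Lambda> \<Longrightarrow> congruent_sets R R'"
    and "\<exists>R\<in>\<Lambda>. x \<in> R"
    and "R \<in> \<Lambda> \<Longrightarrow> R' \<in> \<Lambda> \<Longrightarrow> R \<noteq> R' \<Longrightarrow> interior R \<inter> interior R' = {}"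
    and "R \<in> \<Lambda> \<Longrightarrow> R' \<in> \<Lambda> \<Longrightarrow> (R \<inter> R') face_of R"
    and "R \<in> \<Lambda> \<Longrightarrow> R' \<in> \<Lambda> \<Longrightarrow> (R \<inter> R') face_of R'"
  using assms unfolding rhombic_lattice_def by auto

lemma congruent_sets_ball:
  assumes "congruent_sets A B" "ball c r \<subseteq> A"
  obtains c' where "ball c' r \<subseteq> B"
proof -
  obtain \<phi> :: "complex \<Rightarrow> complex" where iso: "\<And>x y. dist (\<phi> x) (\<phi> y) = dist x y" and B: "\<phi> ` A = B"
    using assms(1) unfolding congruent_sets_def by auto
  have "orthogonal_transformation (\<lambda>x. \<phi> x - \<phi> 0)"
    unfolding orthogonal_transformation_isometry using iso by (simp add: dist_norm)
  then have sur: "surj (\<lambda>x. \<phi> x - \<phi> 0)" by (rule orthogonal_transformation_surj)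
  have "ball (\<phi> c) r \<subseteq> B"
  proof
    fix y assume y: "y \<in> ball (\<phi> c) r"
    obtain x where "y - \<phi> 0 = \<phi> x - \<phi> 0" using surjD[OF sur, of "y - \<phi> 0"] by blast
    then have x: "y = \<phi> x" by simp
    then have "x \<in> ball c r" using y iso by simp
    then show "y \<in> B" using x assms(2) B by blast
  qed
  then show ?thesis by (rule that)
qed

text \<open>Each tile contains a disc of one common radius, by congruence, and the centres of these
  discs are uniformly separated; so a bounded region meets only finitely many tiles.\<close>

lemma rhombic_lattice_finite_near:
  assumes L: "rhombic_lattice \<Lambda>"
  shows "finite {R \<in> \<Lambda>. R \<inter> ball x 1 \<noteq> {}}" (is "finite ?T")
proof -
  obtain R0 where R0: "R0 \<in> \<Lambda>" using rhombic_latticeD(3)[OF L] by blast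
  then have "interior R0 \<noteq> {}" using unit_rhombus_interior rhombic_latticeD(1)[OF L] by blast
  then obtain c0 r where r: "r > 0" and "ball c0 r \<subseteq> R0"
    by (meson all_not_in_conv mem_interior)
  then have "\<forall>R\<in>\<Lambda>. \<exists>c. ball c r \<subseteq> R"
    using rhombic_latticeD(2)[OF L R0] congruent_sets_ball by metis
  then obtain c where c: "\<And>R. R \<in> \<Lambda> \<Longrightarrow> ball (c R) r \<subseteq> R" by metis
  have int: "ball (c R) r \<subseteq> interior R" if "R \<in> \<Lambda>" for R
    using c[OF that] by (simp add: interior_maximal)
  have sep: "r \<le> dist (c R) (c R')" if "R \<in> \<Lambda>" "R' \<in> \<Lambda>" "R \<noteq> R'" for R R'
  proof (rule ccontr)
    assume "\<not> r \<le> dist (c R) (c R')"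
    then have "c R' \<in> ball (c R) r" "c R' \<in> ball (c R') r" using r by auto
    then show False using rhombic_latticeD(4)[OF L that] int that by blast
  qed
  have inj: "inj_on c ?T" using sep r by (fastforce intro: inj_onI)
  have bd: "bounded (c ` ?T)"
  proof (rule boundedI)
    fix y assume "y \<in> c ` ?T"
    then obtain R where R: "R \<in> \<Lambda>" "y = c R" "R \<inter> ball x 1 \<noteq> {}" by blast
    then obtain z where z: "z \<in> R" "dist x z < 1" by auto
    have "y \<in> R" using c[OF R(1)] R(2) r by (meson centre_in_ball subsetD)
    then have "dist y z \<le> 4" using unit_rhombus_dist_le rhombic_latticeD(1)[OF L] R(1) z(1) by blast
    moreover have "dist y 0 \<le> dist y z + dist x z + dist x 0"
      using dist_triangle[of y 0 z] dist_triangle[of z 0 x] by (simp add: dist_commute)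
    ultimately show "norm y \<le> 5 + norm x" using z by simp
  qed
  have "finite (c ` ?T)"
  proof (rule ccontr)
    assume "infinite (c ` ?T)"
    moreover have "compact (closure (c ` ?T))" using bd by (simp add: compact_closure)
    ultimately obtain l where "l islimpt (c ` ?T)"
      by (metis Heine_Borel_imp_Bolzano_Weierstrass closure_subset)
    moreover have "\<not> l islimpt (c ` ?T)"
    proof (rule discrete_imp_not_islimpt[OF r])
      fix x y assume "x \<in> c ` ?T" "y \<in> c ` ?T" "dist y x < r"
      then show "y = x" using sep by fastforce
    qed
    ultimately show False by blast
  qed
  then show ?thesis using inj finite_imageD by blast
qed

text \<open>Near \<open>x\<close> only the tiles through \<open>x\<close> are met.\<close>

lemma rhombic_lattice_locally_finite:
  assumes L: "rhombic_lattice \<Lambda>"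
  obtains e where "e > 0" "\<And>R y. R \<in> \<Lambda> \<Longrightarrow> y \<in> R \<Longrightarrow> dist x y < e \<Longrightarrow> x \<in> R"
proof -
  let ?F = "{R \<in> \<Lambda>. R \<inter> ball x 1 \<noteq> {} \<and> x \<notin> R}"
  have "finite ?F" by (rule finite_subset[OF _ rhombic_lattice_finite_near[OF L, of x]]) auto
  moreover have "closed R" if "R \<in> ?F" for R
    using that unit_rhombus_compact_convex(1) rhombic_latticeD(1)[OF L] compact_imp_closed by blast
  ultimately have "closed (\<Union>?F)" by (intro closed_Union) auto
  then have "open (- \<Union>?F \<inter> ball x 1)" by (intro open_Int) auto
  moreover have "x \<in> - \<Union>?F \<inter> ball x 1" by auto
  ultimately obtain e where e: "e > 0" "ball x e \<subseteq> - \<Union>?F \<inter> ball x 1"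
    by (meson open_contains_ball)
  have "x \<in> R" if "R \<in> \<Lambda>" "y \<in> R" "dist x y < e" for R y
  proof (rule ccontr)
    assume "x \<notin> R"
    moreover have y: "y \<in> - \<Union>?F" "y \<in> ball x 1"
      using e(2) that(3) by (meson IntE mem_ball subsetD)+
    moreover have "R \<inter> ball x 1 \<noteq> {}" using y(2) that(2) by blast
    ultimately show False using that by blast
  qed
  then show ?thesis using that e(1) by blast
qed

lemma edges_sym: "(a, b) \<in> edges \<Lambda> \<Longrightarrow> (b, a) \<in> edges \<Lambda>"
  by (auto simp: edges_def closed_segment_commute)

lemma edge_extreme_points:
  assumes "closed_segment a b edge_of R"
  shows "a extreme_point_of R" "b extreme_point_of R" "a \<in> R" "b \<in> R"
proof -
  have "closed_segment a b face_of R" using assms by (simp add: edge_of_def)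
  then show "a extreme_point_of R" "b extreme_point_of R"
    using extreme_point_of_face extreme_point_of_segment by blast+
  then show "a \<in> R" "b \<in> R" by (simp_all add: extreme_point_of_def)
qed

lemma edges_vertices:
  assumes "(a, b) \<in> edges \<Lambda>"
  shows "a \<in> vertices \<Lambda>" "b \<in> vertices \<Lambda>"
  using assms edge_extreme_points unfolding edges_def vertices_def by blast+

lemma edge_norm:
  assumes "rhombic_lattice \<Lambda>" "(a, b) \<in> edges \<Lambda>"
  shows "norm (b - a) = 1"
  using assms unit_rhombus_edge_norm rhombic_latticeD(1)[OF assms(1)] unfolding edges_def by blast

text \<open>The common face of two distinct tiles has no interior, so it is an edge of both unless it has at
  most one point.\<close>

lemma tiles_common_edge:
  assumes L: "rhombic_lattice \<Lambda>" and R: "R \<in> \<Lambda>" "R' \<in> \<Lambda>" "R \<noteq> R'"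
    and xy: "x \<in> R \<inter> R'" "y \<in> R \<inter> R'" "x \<noteq> y"
  obtains a b where "R \<inter> R' = closed_segment a b"
    "closed_segment a b edge_of R" "closed_segment a b edge_of R'"
proof -
  note U = rhombic_latticeD(1)[OF L R(1)] rhombic_latticeD(1)[OF L R(2)]
  have nR: "R \<inter> R' \<noteq> R" "R \<inter> R' \<noteq> R'"
  proof -
    have "interior (R \<inter> R') = {}" using rhombic_latticeD(4)[OF L R] by simp
    then show "R \<inter> R' \<noteq> R" "R \<inter> R' \<noteq> R'" using unit_rhombus_interior U by metis+
  qed
  obtain a b where ab: "R \<inter> R' = closed_segment a b" "R \<inter> R' edge_of R"
    using rhombus_proper_face_with_two_points[OF U(1) rhombic_latticeD(5)[OF L R(1,2)] nR(1) xy] .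
  moreover have "R \<inter> R' edge_of R'"
    using rhombus_proper_face_with_two_points[OF U(2) rhombic_latticeD(6)[OF L R(1,2)] nR(2) xy] .
  ultimately show ?thesis using that by metis
qed

section \<open>Connectedness of the edge graph\<close>

lemma lattice_path_single: "a \<in> vertices \<Lambda> \<Longrightarrow> lattice_path \<Lambda> a a [a]"
  by (simp add: lattice_path_def)

lemma lattice_path_snoc:
  assumes p: "lattice_path \<Lambda> a b zs" and e: "(b, c) \<in> edges \<Lambda>"
  shows "lattice_path \<Lambda> a c (zs @ [c])"
proof -
  have zs: "zs \<noteq> []" "hd zs = a" "last zs = b" "set zs \<subseteq> vertices \<Lambda>"
    and st: "\<And>n. n \<in> {1..<length zs} \<Longrightarrow> (zs ! (n - 1), zs ! n) \<in> edges \<Lambda>"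
    using p unfolding lattice_path_def by auto
  have "((zs @ [c]) ! (n - 1), (zs @ [c]) ! n) \<in> edges \<Lambda>" if n: "n \<in> {1..<length (zs @ [c])}" for n
  proof (cases "n < length zs")
    case True
    then show ?thesis using st[of n] n by (simp add: nth_append less_imp_diff_less)
  next
    case False
    then have "n = length zs" using n by simp
    then show ?thesis using zs(1,3) e by (simp add: nth_append last_conv_nth)
  qed
  then show ?thesis
    using zs edges_vertices(2)[OF e] unfolding lattice_path_def by simp
qed

lemma lattice_path_snocD:
  assumes p: "lattice_path \<Lambda> a b (zs @ [c])" and ne: "zs \<noteq> []"
  shows "lattice_path \<Lambda> a (last zs) zs" "(last zs, c) \<in> edges \<Lambda>" "c = b"
proof -
  have st: "((zs @ [c]) ! (n - 1), (zs @ [c]) ! n) \<in> edges \<Lambda>" if "n \<in> {1..<length (zs @ [c])}" for n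
    using p that unfolding lattice_path_def by blast
  have "length zs \<in> {1..<length (zs @ [c])}" using ne by (simp add: Suc_leI)
  from st[OF this] show "(last zs, c) \<in> edges \<Lambda>"
    using ne by (simp add: nth_append last_conv_nth)
  have "(zs ! (n - 1), zs ! n) \<in> edges \<Lambda>" if "n \<in> {1..<length zs}" for n
    using st[of n] that by (simp add: nth_append less_imp_diff_less)
  then show "lattice_path \<Lambda> a (last zs) zs"
    using p ne unfolding lattice_path_def by simp
  show "c = b" using p unfolding lattice_path_def by simp
qed

text \<open>\<open>b\<close> is joined to \<open>a\<close> by a path along edges.\<close>

definition reachable :: "complex set set \<Rightarrow> complex \<Rightarrow> complex \<Rightarrow> bool" where
  "reachable \<Lambda> a b \<longleftrightarrow> (\<exists>zs. lattice_path \<Lambda> a b zs)"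

lemma reachable_step: "reachable \<Lambda> a b \<Longrightarrow> (b, c) \<in> edges \<Lambda> \<Longrightarrow> reachable \<Lambda> a c"
  unfolding reachable_def using lattice_path_snoc by blast

lemma reachable_in_tile:
  assumes L: "rhombic_lattice \<Lambda>" and R: "R \<in> \<Lambda>"
    and b: "b extreme_point_of R" "reachable \<Lambda> a b" and c: "c extreme_point_of R"
  shows "reachable \<Lambda> a c"
proof -
  obtain p u v where uv: "norm u = 1" "norm v = 1" "u \<noteq> v" "u \<noteq> - v"
    and Re: "R = convex hull {p, p + u, p + u + v, p + v}"
    using rhombic_latticeD(1)[OF L R] unfolding unit_rhombus_def by blast
  have e: "(p, p + u) \<in> edges \<Lambda>" "(p + u, p + u + v) \<in> edges \<Lambda>"
    "(p + u + v, p + v) \<in> edges \<Lambda>" "(p + v, p) \<in> edges \<Lambda>"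
    using rhombus_corner_cycle[OF uv Re] R unfolding edges_def by blast+
  note e = e e[THEN edges_sym]
  have "b \<in> {p, p + u, p + u + v, p + v}" "c \<in> {p, p + u, p + u + v, p + v}"
    using b(1) c extreme_point_of_convex_hull Re by blast+
  then show ?thesis using b(2) e reachable_step[of \<Lambda> a] by blast
qed

text \<open>Intersecting tiles share a vertex, namely an extreme point of their common face. Hence the
  union of the tiles with vertices reachable from \<open>a\<close> and the union of the other tiles are
  disjoint; by local finiteness both are open, and the plane is connected.\<close>

lemma lattice_connected:
  assumes L: "rhombic_lattice \<Lambda>" and a: "a \<in> vertices \<Lambda>" and b: "b \<in> vertices \<Lambda>"
  obtains zs where "lattice_path \<Lambda> a b zs"
proof -
  define Q where "Q R \<longleftrightarrow> (\<forall>z. z extreme_point_of R \<longrightarrow> reachable \<Lambda> a z)" for R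
  have QI: "Q R" if "R \<in> \<Lambda>" "z extreme_point_of R" "reachable \<Lambda> a z" for R z
    unfolding Q_def using reachable_in_tile[OF L that] by blast
  have spread: "Q R'" if RR: "R \<in> \<Lambda>" "R' \<in> \<Lambda>" "x \<in> R" "x \<in> R'" "Q R" for R R' x
  proof -
    have "compact (R \<inter> R')" "convex (R \<inter> R')"
      using unit_rhombus_compact_convex rhombic_latticeD(1)[OF L] RR compact_Int convex_Int by metis+
    moreover have "R \<inter> R' \<noteq> {}" using RR by blast
    ultimately obtain z where "z extreme_point_of (R \<inter> R')" by (rule extreme_point_exists_convex)
    then have "z extreme_point_of R" "z extreme_point_of R'"
      using extreme_point_of_face rhombic_latticeD(5,6)[OF L RR(1,2)] by blast+
    then show ?thesis using QI RR unfolding Q_def by blast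
  qed
  define P where "P x \<longleftrightarrow> (\<exists>R\<in>\<Lambda>. x \<in> R \<and> Q R)" for x
  have PI: "P x \<longleftrightarrow> Q R" if "R \<in> \<Lambda>" "x \<in> R" for x R
    unfolding P_def using spread that by blast
  have loc: "\<exists>e>0. \<forall>y. dist x y < e \<longrightarrow> (P y \<longleftrightarrow> P x)" for x
  proof -
    obtain e where e: "e > 0" "\<And>R y. R \<in> \<Lambda> \<Longrightarrow> y \<in> R \<Longrightarrow> dist x y < e \<Longrightarrow> x \<in> R"
      using rhombic_lattice_locally_finite[OF L, of x] by blast
    have "P y \<longleftrightarrow> P x" if "dist x y < e" for y
    proof -
      obtain R where "R \<in> \<Lambda>" "y \<in> R" using rhombic_latticeD(3)[OF L] by blast
      then show ?thesis using PI e(2) that by blast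
    qed
    then show ?thesis using e(1) by blast
  qed
  have "open {x. P x}" "open {x. \<not> P x}"
    using loc unfolding open_dist by (auto simp: dist_commute) (metis dist_commute)+
  then have "{x. P x} = {} \<or> {x. \<not> P x} = {}"
    using connectedD[OF connected_UNIV, of "{x. P x}" "{x. \<not> P x}"] by auto
  moreover obtain R where "R \<in> \<Lambda>" "a extreme_point_of R" using a unfolding vertices_def by blast
  moreover have "reachable \<Lambda> a a" using lattice_path_single[OF a] by (auto simp: reachable_def)
  ultimately have Pall: "P x" for x
    using PI[of R a] QI[of R a] by (auto simp: extreme_point_of_def)
  obtain R where "R \<in> \<Lambda>" "b extreme_point_of R" using b unfolding vertices_def by blast
  then have "reachable \<Lambda> a b" using Pall[of b] PI unfolding Q_def extreme_point_of_def by blast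
  then show ?thesis using that unfolding reachable_def by blast
qed

section \<open>Potentials of forms that are constant on tiles\<close>

text \<open>A real-linear form on each tile, such that the forms of two tiles agree along their common face:
  a closed differential form on the plane that is constant on tiles.\<close>

locale tile_forms =
  fixes \<Lambda> :: "complex set set" and \<omega> :: "complex set \<Rightarrow> complex \<Rightarrow> complex"
  assumes lattice: "rhombic_lattice \<Lambda>"
    and linear_form: "R \<in> \<Lambda> \<Longrightarrow> linear (\<omega> R)"
    and compatible: "R \<in> \<Lambda> \<Longrightarrow> R' \<in> \<Lambda> \<Longrightarrow> x \<in> R \<inter> R' \<Longrightarrow> y \<in> R \<inter> R' \<Longrightarrow> \<omega> R (y - x) = \<omega> R' (y - x)"
begin

text \<open>A potential on \<open>X\<close> of the family of forms. Neither continuity nor openness of \<open>X\<close> is required;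
  on connected \<open>X\<close>, local finiteness of the tiling still makes potentials unique up to a constant.\<close>

definition potential_on :: "complex set \<Rightarrow> (complex \<Rightarrow> complex) \<Rightarrow> bool" where
  "potential_on X f \<longleftrightarrow> (\<forall>R\<in>\<Lambda>. \<forall>x\<in>X \<inter> R. \<forall>y\<in>X \<inter> R. f y - f x = \<omega> R (y - x))"

lemma potential_onD:
  "potential_on X f \<Longrightarrow> R \<in> \<Lambda> \<Longrightarrow> x \<in> X \<Longrightarrow> x \<in> R \<Longrightarrow> y \<in> X \<Longrightarrow> y \<in> R \<Longrightarrow> f y - f x = \<omega> R (y - x)"
  unfolding potential_on_def by blast

lemma potential_on_subset: "potential_on X f \<Longrightarrow> Y \<subseteq> X \<Longrightarrow> potential_on Y f"
  unfolding potential_on_def by blast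

text \<open>All tiles met near \<open>x\<close> contain \<open>x\<close>, and \<open>y \<mapsto> \<omega> R (y - x)\<close> does not depend on the tile \<open>R\<close>
  through \<open>y\<close>.\<close>

lemma local_potential: "\<exists>e>0. \<exists>f. potential_on (ball x e) f"
proof -
  obtain e where e: "e > 0" "\<And>R y. R \<in> \<Lambda> \<Longrightarrow> y \<in> R \<Longrightarrow> dist x y < e \<Longrightarrow> x \<in> R"
    using rhombic_lattice_locally_finite[OF lattice, of x] by blast
  define f where "f y = \<omega> (SOME R. R \<in> \<Lambda> \<and> y \<in> R) (y - x)" for y
  have f: "f y = \<omega> R (y - x)" if "R \<in> \<Lambda>" "y \<in> R" "dist x y < e" for R y
  proof -
    let ?R = "SOME R. R \<in> \<Lambda> \<and> y \<in> R"
    have "?R \<in> \<Lambda> \<and> y \<in> ?R" by (rule someI[of _ R]) (use that in blast)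
    then show ?thesis unfolding f_def using compatible[of ?R R x y] e(2) that by blast
  qed
  have "potential_on (ball x e) f"
    unfolding potential_on_def
  proof (intro ballI)
    fix R y z assume R: "R \<in> \<Lambda>" "y \<in> ball x e \<inter> R" "z \<in> ball x e \<inter> R"
    then have "f z - f y = \<omega> R (z - x) - \<omega> R (y - x)" using f by simp
    also have "\<dots> = \<omega> R (z - y)" using linear_diff[OF linear_form[OF R(1)], of "z - x" "y - x"] by simp
    finally show "f z - f y = \<omega> R (z - y)" .
  qed
  then show ?thesis using e(1) by blast
qed

lemma potential_unique:
  assumes "potential_on X f" "potential_on X g" "connected X" "x \<in> X" "y \<in> X"
  shows "f x - g x = f y - g y"
proof (rule connected_local_const[where f = "\<lambda>z. f z - g z", OF assms(3-5)], rule ballI)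
  fix a assume a: "a \<in> X"
  obtain e where e: "e > 0" "\<And>R y. R \<in> \<Lambda> \<Longrightarrow> y \<in> R \<Longrightarrow> dist a y < e \<Longrightarrow> a \<in> R"
    using rhombic_lattice_locally_finite[OF lattice, of a] by blast
  have "f a - g a = f b - g b" if b: "b \<in> X" "dist a b < e" for b
  proof -
    obtain R where R: "R \<in> \<Lambda>" "b \<in> R" using rhombic_latticeD(3)[OF lattice] by blast
    then have "a \<in> R" using e(2) b by blast
    then have "f b - f a = g b - g a"
      using potential_onD[OF assms(1) R(1) a _ b(1) R(2)] potential_onD[OF assms(2) R(1) a _ b(1) R(2)]
      by simp
    then show ?thesis by (simp add: algebra_simps)
  qed
  then show "\<forall>\<^sub>F b in at a within X. f a - g a = f b - g b"
    using e(1) unfolding eventually_at by (metis dist_commute)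
qed

lemma potential_glue:
  fixes k :: complex
  assumes X: "convex X"
    and f: "potential_on (X \<inter> {x. x \<bullet> k \<le> c}) f" and g: "potential_on (X \<inter> {x. x \<bullet> k \<ge> c}) g"
  shows "\<exists>h. potential_on X h"
proof -
  let ?A = "X \<inter> {x. x \<bullet> k \<le> c}" and ?B = "X \<inter> {x. x \<bullet> k \<ge> c}"
  let ?W = "X \<inter> {x. k \<bullet> x = c}"
  have "connected ?W" using X by (intro convex_connected convex_Int convex_hyperplane)
  moreover have "potential_on ?W f" "potential_on ?W g"
    using f g by (auto intro: potential_on_subset simp: inner_commute)
  ultimately have diff: "f x - g x = f y - g y" if "x \<in> ?W" "y \<in> ?W" for x y
    using potential_unique that by blast
  obtain d where d: "\<And>x. x \<in> ?W \<Longrightarrow> f x = g x + d"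
  proof (cases "?W = {}")
    case True
    then show ?thesis using that by blast
  next
    case False
    then obtain y where "y \<in> ?W" by blast
    then show ?thesis using that[of "f y - g y"] diff by (metis diff_eq_eq add.commute)
  qed
  define h where "h x = (if x \<bullet> k \<le> c then f x else g x + d)" for x
  have hf: "h x = f x" if "x \<in> ?A" for x using that by (simp add: h_def)
  have hg: "h x = g x + d" if "x \<in> ?B" for x
    using that d[of x] by (auto simp: h_def inner_commute)
  have AA: "h y - h x = \<omega> R (y - x)" if "R \<in> \<Lambda>" "x \<in> ?A \<inter> R" "y \<in> ?A \<inter> R" for R x y
    using potential_onD[OF f that(1)] that hf by auto
  have BB: "h y - h x = \<omega> R (y - x)" if "R \<in> \<Lambda>" "x \<in> ?B \<inter> R" "y \<in> ?B \<inter> R" for R x y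
    using potential_onD[OF g that(1)] that hg by auto
  \<comment> \<open>The segment from one side to the other stays in \<open>X \<inter> R\<close> and crosses the dividing line.\<close>
  have AB: "h y - h x = \<omega> R (y - x)" if R: "R \<in> \<Lambda>" and x: "x \<in> ?A \<inter> R" and y: "y \<in> ?B \<inter> R" for R x y
  proof -
    have cXR: "convex (X \<inter> R)"
      using X unit_rhombus_compact_convex(2)[OF rhombic_latticeD(1)[OF lattice R]] convex_Int by blast
    have "connected (closed_segment x y)" by simp
    then obtain w where w: "w \<in> closed_segment x y" "k \<bullet> w = c"
      using connected_ivt_hyperplane[of "closed_segment x y" x y k c] x y by (auto simp: inner_commute)
    have "w \<in> X \<inter> R" using w(1) closed_segment_subset[OF _ _ cXR, of x y] x y by blast
    then have w2: "w \<in> ?A \<inter> R" "w \<in> ?B \<inter> R" using w(2) by (auto simp: inner_commute)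
    have "h y - h x = (h y - h w) + (h w - h x)" by simp
    also have "\<dots> = \<omega> R (y - w) + \<omega> R (w - x)" using AA[OF R x w2(1)] BB[OF R w2(2) y] by simp
    also have "\<dots> = \<omega> R (y - x)" using linear_add[OF linear_form[OF R], of "y - w" "w - x"] by simp
    finally show ?thesis .
  qed
  have "potential_on X h"
    unfolding potential_on_def
  proof (intro ballI)
    fix R x y assume R: "R \<in> \<Lambda>" and x: "x \<in> X \<inter> R" and y: "y \<in> X \<inter> R"
    consider "x \<in> ?A" "y \<in> ?A" | "x \<in> ?B" "y \<in> ?B" | "x \<in> ?A" "y \<in> ?B" | "x \<in> ?B" "y \<in> ?A"
      using x y by fastforce
    then show "h y - h x = \<omega> R (y - x)"
    proof cases
      case 4
      then have "h x - h y = \<omega> R (x - y)" using AB[OF R] x y by blast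
      then show ?thesis using linear_neg[OF linear_form[OF R], of "x - y"] by (simp add: algebra_simps)
    qed (use AA BB AB R x y in blast)+
  qed
  then show ?thesis by blast
qed

text \<open>Existence of a potential is an additive property of boxes, so it passes from small boxes to large
  ones. Boxes without interior are admitted separately, because the additivity principle for
  functions of boxes requires the value on them to be trivial.\<close>

lemma potential_operative:
  "operative (\<and>) True (\<lambda>X. interior X = {} \<or> (\<exists>f. potential_on X f))"
proof (intro operative.intro operative_axioms.intro)
  show "comm_monoid_set (\<and>) True"
    by unfold_locales auto
next
  fix a b :: complex assume "box a b = {}"
  then show "(interior (cbox a b) = {} \<or> (\<exists>f. potential_on (cbox a b) f)) = True"
    by (simp add: interior_cbox)
next
  fix a b k :: complex and c :: real
  let ?X = "cbox a b" and ?A = "cbox a b \<inter> {x. x \<bullet> k \<le> c}" and ?B = "cbox a b \<inter> {x. x \<bullet> k \<ge> c}"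
  let ?P = "\<lambda>X. interior X = {} \<or> (\<exists>f. potential_on X f)"
  assume "k \<in> Basis"
  have clA: "closed ?A" and clB: "closed ?B"
    using closed_halfspace_le[of k c] closed_halfspace_ge[of c k]
    by (auto simp: inner_commute intro!: closed_Int)
  have XAB: "?X = ?A \<union> ?B" by auto
  have mono: "?P Y" if "?P Z" "Y \<subseteq> Z" for Y Z
    using that potential_on_subset interior_mono[OF that(2)] by blast
  \<comment> \<open>A closed part without interior is redundant in a box with interior, because the box is the
    closure of its interior.\<close>
  have sub: "?X \<subseteq> Z" if "interior Y = {}" "?X = Y \<union> Z" "closed Y" "closed Z" "interior ?X \<noteq> {}" for Y Z
  proof -
    have "interior ?X - Z \<subseteq> Y" using that(2) interior_subset by blast
    moreover have "open (interior ?X - Z)" using that(4) by (intro open_Diff) auto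
    ultimately have "interior ?X - Z \<subseteq> interior Y" by (simp add: interior_maximal)
    then have "interior ?X \<subseteq> Z" using that(1) by blast
    then have "closure (interior ?X) \<subseteq> Z" using that(4) by (simp add: closure_minimal)
    then show ?thesis
      using convex_closure_interior[of ?X] that(5) convex_box(1)[of a b] by simp
  qed
  show "?P ?X = (?P ?A \<and> ?P ?B)"
  proof
    assume "?P ?X"
    then show "?P ?A \<and> ?P ?B" using mono[of ?X ?A] mono[of ?X ?B] by blast
  next
    assume P: "?P ?A \<and> ?P ?B"
    show "?P ?X"
    proof (cases "interior ?X = {} \<or> ?X \<subseteq> ?A \<or> ?X \<subseteq> ?B")
      case True
      then show ?thesis using mono[of ?A ?X] mono[of ?B ?X] P by blast
    next
      case False
      then have "interior ?A \<noteq> {}" "interior ?B \<noteq> {}"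
        using sub[of ?A ?B] sub[of ?B ?A] XAB clA clB by blast+
      then obtain f g where "potential_on ?A f" "potential_on ?B g" using P by blast
      then show ?thesis using potential_glue[OF convex_box(1)] by blast
    qed
  qed
qed

lemma potential_on_cbox:
  assumes "box a b \<noteq> {}"
  shows "\<exists>f. potential_on (cbox a b) f"
proof -
  let ?P = "\<lambda>X. interior X = {} \<or> (\<exists>f. potential_on X f)"
  interpret P: operative "(\<and>)" True ?P by (rule potential_operative)
  obtain e where e: "\<And>x. e x > 0 \<and> (\<exists>f. potential_on (ball x (e x)) f)"
    using local_potential by metis
  have "gauge (\<lambda>x. ball x (e x))" using e by (simp add: gauge_def)
  then obtain p where p: "p tagged_division_of (cbox a b)" "(\<lambda>x. ball x (e x)) fine p"
    by (rule fine_division_exists)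
  have d: "snd ` p division_of (cbox a b)" using p(1) by (rule division_of_tagged_division)
  have "?P K" if K: "K \<in> snd ` p" for K
  proof -
    obtain x where "(x, K) \<in> p" using K by auto
    then have "K \<subseteq> ball x (e x)" using p(2) unfolding fine_def by blast
    then show ?thesis using e potential_on_subset by blast
  qed
  then have "P.F ?P (snd ` p)" using P.neutral[of "snd ` p" ?P] by simp
  then have "?P (cbox a b)" using P.division[OF d] by simp
  then show ?thesis using assms by (simp add: interior_cbox)
qed

lemma potential_on_bounded:
  assumes "bounded X"
  obtains f where "potential_on X f"
proof -
  have "bounded (insert 0 X)" using assms by simp
  then obtain a where a: "insert 0 X \<subseteq> box (- a) a" using bounded_subset_box_symmetric by blast
  then have "box (- a) a \<noteq> {}" by blast
  then obtain f where "potential_on (cbox (- a) a) f" using potential_on_cbox by blast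
  moreover have "X \<subseteq> cbox (- a) a" using a box_subset_cbox by blast
  ultimately show ?thesis using that potential_on_subset by blast
qed

end

section \<open>Path independence\<close>

text \<open>On the edges between vertices of a bounded set, an odd function of the edge vector is the
  increment of a function of the end points.\<close>

lemma edge_potential:
  fixes l :: "complex \<Rightarrow> complex"
  assumes L: "rhombic_lattice \<Lambda>" and odd: "\<And>d. norm d = 1 \<Longrightarrow> l (- d) = - l d" and W: "bounded W"
  obtains f where "\<And>a b. (a, b) \<in> edges \<Lambda> \<Longrightarrow> a \<in> W \<Longrightarrow> b \<in> W \<Longrightarrow> f b - f a = l (b - a)"
proof -
  have "\<forall>R\<in>\<Lambda>. \<exists>\<omega>. linear \<omega> \<and> (\<forall>a b. closed_segment a b edge_of R \<longrightarrow> \<omega> (b - a) = l (b - a))"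
  proof
    fix R assume "R \<in> \<Lambda>"
    then obtain \<omega> where "linear \<omega>" "\<And>a b. closed_segment a b edge_of R \<Longrightarrow> \<omega> (b - a) = l (b - a)"
      using unit_rhombus_edge_form[where l = l, OF rhombic_latticeD(1)[OF L] odd] by blast
    then show "\<exists>\<omega>. linear \<omega> \<and> (\<forall>a b. closed_segment a b edge_of R \<longrightarrow> \<omega> (b - a) = l (b - a))" by blast
  qed
  from bchoice[OF this] obtain \<omega> where lin: "\<And>R. R \<in> \<Lambda> \<Longrightarrow> linear (\<omega> R)"
    and edge: "\<And>R a b. R \<in> \<Lambda> \<Longrightarrow> closed_segment a b edge_of R \<Longrightarrow> \<omega> R (b - a) = l (b - a)"
    by blast
  interpret tile_forms \<Lambda> \<omega>
  proof (rule tile_forms.intro)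
    fix R R' x y
    assume R: "R \<in> \<Lambda>" "R' \<in> \<Lambda>" and xy: "x \<in> R \<inter> R'" "y \<in> R \<inter> R'"
    show "\<omega> R (y - x) = \<omega> R' (y - x)"
    proof (cases "R = R' \<or> x = y")
      case True
      then show ?thesis using linear_0[OF lin[OF R(1)]] linear_0[OF lin[OF R(2)]] by auto
    next
      case False
      then obtain a b where ab: "R \<inter> R' = closed_segment a b"
        "closed_segment a b edge_of R" "closed_segment a b edge_of R'"
        using tiles_common_edge[OF L R _ xy] by blast
      obtain s t where "x = (1 - s) *\<^sub>R a + s *\<^sub>R b" "y = (1 - t) *\<^sub>R a + t *\<^sub>R b"
        using xy unfolding ab(1) closed_segment_def by blast
      then have "y - x = (t - s) *\<^sub>R (b - a)"
        by (simp only: scaleR_diff_left scaleR_diff_right scaleR_one) simp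
      then show ?thesis
        using edge[OF R(1) ab(2)] edge[OF R(2) ab(3)]
          linear_scale[OF lin[OF R(1)]] linear_scale[OF lin[OF R(2)]] by simp
    qed
  qed (use L lin in blast)+
  obtain f where f: "potential_on W f" using potential_on_bounded[OF W] .
  have "f b - f a = l (b - a)" if e: "(a, b) \<in> edges \<Lambda>" and "a \<in> W" "b \<in> W" for a b
  proof -
    obtain R where R: "R \<in> \<Lambda>" "closed_segment a b edge_of R" using e unfolding edges_def by blast
    then have "a \<in> R" "b \<in> R" using edge_extreme_points by blast+
    then show ?thesis using potential_onD[OF f R(1)] edge[OF R] that by simp
  qed
  then show ?thesis using that by blast
qed

lemma step_index_snoc: "zs \<noteq> [] \<Longrightarrow> {1..<length (zs @ [c])} = insert (length zs) {1..<length zs}"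
  by (cases zs) auto

lemma sum_steps_snoc:
  fixes s :: "'b \<Rightarrow> 'b \<Rightarrow> 'a::ab_group_add"
  assumes "zs \<noteq> []"
  shows "(\<Sum>n\<in>{1..<length (zs @ [c])}. s ((zs @ [c]) ! (n - 1)) ((zs @ [c]) ! n))
    = (\<Sum>n\<in>{1..<length zs}. s (zs ! (n - 1)) (zs ! n)) + s (last zs) c"
proof -
  have "(\<Sum>n\<in>{1..<length zs}. s ((zs @ [c]) ! (n - 1)) ((zs @ [c]) ! n))
      = (\<Sum>n\<in>{1..<length zs}. s (zs ! (n - 1)) (zs ! n))"
    by (rule sum.cong) (auto simp: nth_append)
  then show ?thesis
    unfolding step_index_snoc[OF assms] using assms by (simp add: nth_append last_conv_nth)
qed

lemma prod_steps_snoc: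
  fixes s :: "'b \<Rightarrow> 'b \<Rightarrow> 'a::comm_monoid_mult"
  assumes "zs \<noteq> []"
  shows "(\<Prod>n\<in>{1..<length (zs @ [c])}. s ((zs @ [c]) ! (n - 1)) ((zs @ [c]) ! n))
    = (\<Prod>n\<in>{1..<length zs}. s (zs ! (n - 1)) (zs ! n)) * s (last zs) c"
proof -
  have "(\<Prod>n\<in>{1..<length zs}. s ((zs @ [c]) ! (n - 1)) ((zs @ [c]) ! n))
      = (\<Prod>n\<in>{1..<length zs}. s (zs ! (n - 1)) (zs ! n))"
    by (rule prod.cong) (auto simp: nth_append)
  then show ?thesis
    unfolding step_index_snoc[OF assms] using assms by (simp add: nth_append last_conv_nth mult.commute)
qed

lemma lattice_path_telescope:
  fixes s :: "complex \<Rightarrow> complex \<Rightarrow> 'a::ab_group_add"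
  assumes "lattice_path \<Lambda> a b zs"
    and "\<And>x y. (x, y) \<in> edges \<Lambda> \<Longrightarrow> x \<in> set zs \<Longrightarrow> y \<in> set zs \<Longrightarrow> s x y = f y - f x"
  shows "(\<Sum>n\<in>{1..<length zs}. s (zs ! (n - 1)) (zs ! n)) = f b - f a"
  using assms
proof (induction zs arbitrary: b rule: rev_induct)
  case Nil
  then show ?case by (simp add: lattice_path_def)
next
  case (snoc c zs)
  show ?case
  proof (cases "zs = []")
    case True
    then show ?thesis using snoc.prems(1) by (auto simp: lattice_path_def)
  next
    case False
    note p = lattice_path_snocD[OF snoc.prems(1) False]
    have IH: "(\<Sum>n\<in>{1..<length zs}. s (zs ! (n - 1)) (zs ! n)) = f (last zs) - f a"
      by (rule snoc.IH[OF p(1)]) (use snoc.prems(2) in simp)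
    have "(\<Sum>n\<in>{1..<length (zs @ [c])}. s ((zs @ [c]) ! (n - 1)) ((zs @ [c]) ! n))
      = (\<Sum>n\<in>{1..<length zs}. s (zs ! (n - 1)) (zs ! n)) + s (last zs) c"
      by (rule sum_steps_snoc[OF False])
    also have "s (last zs) c = f c - f (last zs)"
      by (rule snoc.prems(2)) (use p False in auto)
    finally show ?thesis using IH p(3) by simp
  qed
qed

text \<open>One potential, on a bounded set containing both paths, telescopes both sums.\<close>

lemma lattice_path_sum_independent:
  fixes l :: "complex \<Rightarrow> complex"
  assumes L: "rhombic_lattice \<Lambda>" and odd: "\<And>d. norm d = 1 \<Longrightarrow> l (- d) = - l d"
    and p: "lattice_path \<Lambda> a b zs" "lattice_path \<Lambda> a b ws"
  shows "(\<Sum>n\<in>{1..<length zs}. l (zs ! n - zs ! (n - 1)))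
    = (\<Sum>n\<in>{1..<length ws}. l (ws ! n - ws ! (n - 1)))"
proof -
  have "bounded (set zs \<union> set ws)" by (simp add: finite_imp_bounded)
  from edge_potential[where l = l, OF L odd this] obtain f where f:
    "\<And>a b. (a, b) \<in> edges \<Lambda> \<Longrightarrow> a \<in> set zs \<union> set ws \<Longrightarrow> b \<in> set zs \<union> set ws \<Longrightarrow> f b - f a = l (b - a)"
    by metis
  have "(\<Sum>n\<in>{1..<length zs}. l (zs ! n - zs ! (n - 1))) = f b - f a"
    by (rule lattice_path_telescope[OF p(1), of "\<lambda>x y. l (y - x)"]) (use f in auto)
  moreover have "(\<Sum>n\<in>{1..<length ws}. l (ws ! n - ws ! (n - 1))) = f b - f a"
    by (rule lattice_path_telescope[OF p(2), of "\<lambda>x y. l (y - x)"]) (use f in auto)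
  ultimately show ?thesis by simp
qed

section \<open>The functions \<open>e\<^sub>t\<close>\<close>

text \<open>The factor that a step \<open>d\<close> of a path contributes to the product defining \<open>e\<^sub>t\<close>.\<close>

definition step_factor :: "complex \<Rightarrow> complex \<Rightarrow> complex" where
  "step_factor t d = (2 + t * (1 + d)) / (2 + t * (1 - d))"

lemma step_denominator_nonzero:
  fixes t d :: complex
  assumes "norm t < 1" "norm d = 1"
  shows "2 + t * (1 - d) \<noteq> 0"
proof
  assume "2 + t * (1 - d) = 0"
  then have "t * (d - 1) = 2" by (simp add: algebra_simps)
  then have "norm t * norm (d - 1) = 2" by (metis norm_mult norm_numeral)
  moreover have "norm (d - 1) \<le> 2" using norm_triangle_ineq4[of d 1] assms by simp
  ultimately have "2 \<le> norm t * 2" by (metis mult_left_mono norm_ge_zero)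
  then show False using assms by simp
qed

text \<open>The factor is \<open>(1 + w) / (1 - w)\<close> with \<open>w = t d / (2 + t)\<close> of modulus less than \<open>1\<close>, so it lies
  in the right half plane. Off the negative axis the principal logarithm is odd under inversion, which
  is what the potential theory of the edges needs.\<close>

lemma step_factor_not_nonpos:
  assumes t: "norm t < 1" and d: "norm d = 1"
  shows "step_factor t d \<notin> \<real>\<^sub>\<le>\<^sub>0"
proof
  assume "step_factor t d \<in> \<real>\<^sub>\<le>\<^sub>0"
  then obtain r where r: "r \<le> 0" "step_factor t d = of_real r" by (auto elim: nonpos_Reals_cases)
  then have "2 + t * (1 + d) = of_real r * (2 + t * (1 - d))"
    using step_denominator_nonzero[OF t d] by (simp add: step_factor_def divide_eq_eq)
  then have "of_real (1 - r) * (2 + t) = - (of_real (1 + r) * (t * d))"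
    by (simp add: algebra_simps)
  then have "\<bar>1 - r\<bar> * norm (2 + t) = \<bar>1 + r\<bar> * norm t"
    by (metis d mult.right_neutral norm_minus_cancel norm_mult norm_of_real)
  moreover have "\<bar>1 + r\<bar> * norm t \<le> \<bar>1 - r\<bar> * norm t"
    using r(1) by (intro mult_right_mono) auto
  moreover have "norm t < norm (2 + t)"
    using norm_diff_ineq[of 2 t] t by simp
  then have "\<bar>1 - r\<bar> * norm t < \<bar>1 - r\<bar> * norm (2 + t)"
    using r(1) by (intro mult_strict_left_mono) auto
  ultimately show False by linarith
qed

lemma step_factor_minus: "step_factor t (- d) = inverse (step_factor t d)"
  by (simp add: step_factor_def)

lemma prod_step_factor_eq_exp:
  assumes L: "rhombic_lattice \<Lambda>" and t: "norm t < 1" and p: "lattice_path \<Lambda> a b zs"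
  shows "(\<Prod>n\<in>{1..<length zs}. step_factor t (zs ! n - zs ! (n - 1)))
    = exp (\<Sum>n\<in>{1..<length zs}. Ln (step_factor t (zs ! n - zs ! (n - 1))))"
proof -
  have "step_factor t (zs ! n - zs ! (n - 1)) \<noteq> 0" if "n \<in> {1..<length zs}" for n
  proof -
    have "(zs ! (n - 1), zs ! n) \<in> edges \<Lambda>" using p that unfolding lattice_path_def by blast
    then show ?thesis using step_factor_not_nonpos[OF t edge_norm[OF L]] by force
  qed
  then show ?thesis by (simp add: exp_sum)
qed

lemma prod_step_factor_independent:
  assumes L: "rhombic_lattice \<Lambda>" and t: "norm t < 1"
    and p: "lattice_path \<Lambda> a b zs" "lattice_path \<Lambda> a b ws"
  shows "(\<Prod>n\<in>{1..<length zs}. step_factor t (zs ! n - zs ! (n - 1)))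
    = (\<Prod>n\<in>{1..<length ws}. step_factor t (ws ! n - ws ! (n - 1)))"
proof -
  have "Ln (step_factor t (- d)) = - Ln (step_factor t d)" if "norm d = 1" for d
    unfolding step_factor_minus using step_factor_not_nonpos[OF t that] by (rule Ln_inverse)
  then show ?thesis
    unfolding prod_step_factor_eq_exp[OF L t p(1)] prod_step_factor_eq_exp[OF L t p(2)]
    using lattice_path_sum_independent[where l = "\<lambda>d. Ln (step_factor t d)", OF L _ p] by simp
qed

lemma e_fun_eq_SOME:
  assumes "z \<in> vertices \<Lambda>" "z \<noteq> 0"
  shows "e_fun \<Lambda> t z = (let zs = (SOME zs. lattice_path \<Lambda> 0 z zs) in
    \<Prod>n\<in>{1..<length zs}. step_factor t (zs ! n - zs ! (n - 1)))"
proof -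
  have "(2 + t * (1 + x - y)) / (2 + t * (1 + y - x)) = step_factor t (x - y)" for x y
    by (simp add: step_factor_def algebra_simps)
  then show ?thesis using assms by (simp add: e_fun_def Let_def)
qed

lemma lattice_path_vertices:
  assumes "lattice_path \<Lambda> a b zs"
  shows "a \<in> vertices \<Lambda>" "b \<in> vertices \<Lambda>"
  using assms unfolding lattice_path_def by auto

lemma e_fun_eq_prod:
  assumes L: "rhombic_lattice \<Lambda>" and t: "norm t < 1" and p: "lattice_path \<Lambda> 0 z zs"
  shows "e_fun \<Lambda> t z = (\<Prod>n\<in>{1..<length zs}. step_factor t (zs ! n - zs ! (n - 1)))"
proof (cases "z = 0")
  case True
  \<comment> \<open>The value \<open>e\<^sub>t(0) = 1\<close> is set separately; it is the product over the trivial closed path.\<close>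
  have "lattice_path \<Lambda> 0 0 [0]" using lattice_path_vertices[OF p] by (intro lattice_path_single)
  then show ?thesis
    using prod_step_factor_independent[OF L t p[unfolded True], of "[0]"] lattice_path_vertices[OF p] True
    by (simp add: e_fun_def)
next
  case False
  then show ?thesis
    using prod_step_factor_independent[OF L t someI[of "lattice_path \<Lambda> 0 z", OF p] p]
      lattice_path_vertices[OF p] by (simp add: e_fun_eq_SOME Let_def)
qed

lemma e_fun_edge:
  assumes L: "rhombic_lattice \<Lambda>" and V: "0 \<in> vertices \<Lambda>" and t: "norm t < 1"
    and e: "(a, b) \<in> edges \<Lambda>"
  shows "e_fun \<Lambda> t b * (2 + t * (1 - (b - a))) = e_fun \<Lambda> t a * (2 + t * (1 + (b - a)))"
proof -
  obtain zs where p: "lattice_path \<Lambda> 0 a zs"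
    using lattice_connected[OF L V edges_vertices(1)[OF e]] .
  have zs: "zs \<noteq> []" "last zs = a" using p unfolding lattice_path_def by auto
  have "e_fun \<Lambda> t b = e_fun \<Lambda> t a * step_factor t (b - a)"
    using prod_steps_snoc[OF zs(1), of "\<lambda>x y. step_factor t (y - x)" b] zs(2)
    by (simp add: e_fun_eq_prod[OF L t p] e_fun_eq_prod[OF L t lattice_path_snoc[OF p e]])
  then show ?thesis
    using step_denominator_nonzero[OF t edge_norm[OF L e]] by (simp add: step_factor_def)
qed

lemma e_fun_holomorphic:
  assumes L: "rhombic_lattice \<Lambda>" and V: "0 \<in> vertices \<Lambda>"
  shows "(\<lambda>t. e_fun \<Lambda> t z) holomorphic_on ball 0 1"
proof (cases "z \<in> vertices \<Lambda>")
  case False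
  then show ?thesis by (simp add: e_fun_def)
next
  case True
  obtain zs where p: "lattice_path \<Lambda> 0 z zs" using lattice_connected[OF L V True] .
  have "2 + t * (1 - (zs ! n - zs ! (n - 1))) \<noteq> 0" if "n \<in> {1..<length zs}" "t \<in> ball 0 1" for n t
  proof -
    have "(zs ! (n - 1), zs ! n) \<in> edges \<Lambda>" using p that unfolding lattice_path_def by blast
    then show ?thesis using step_denominator_nonzero[OF _ edge_norm[OF L]] that by simp
  qed
  then have "(\<lambda>t. \<Prod>n\<in>{1..<length zs}. step_factor t (zs ! n - zs ! (n - 1))) holomorphic_on ball 0 1"
    unfolding step_factor_def by (intro holomorphic_intros) auto
  then show ?thesis
    by (rule holomorphic_transform) (simp add: e_fun_eq_prod[OF L _ p])
qed

section \<open>Taylor coefficients\<close>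

lemma z_power_sums:
  assumes L: "rhombic_lattice \<Lambda>" and V: "0 \<in> vertices \<Lambda>" and t: "norm t < 1"
  shows "(\<lambda>n. t ^ n * z_power \<Lambda> n z) sums e_fun \<Lambda> t z"
  using holomorphic_power_series[OF e_fun_holomorphic[OF L V], of t z] t
  by (simp add: z_power_def mult.commute)

lemma z_power_zero:
  assumes V: "0 \<in> vertices \<Lambda>"
  shows "z_power \<Lambda> n 0 = (if n = 0 then 1 else 0)"
  using V by (simp add: z_power_def e_fun_def)

lemma z_power_outside: "z \<notin> vertices \<Lambda> \<Longrightarrow> z_power \<Lambda> n z = 0"
  by (simp add: z_power_def e_fun_def)

lemma z_power_0:
  assumes "z \<in> vertices \<Lambda>"
  shows "z_power \<Lambda> 0 z = 1"
  using assms by (cases "z = 0") (simp_all add: z_power_def e_fun_def Let_def)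

text \<open>The edge relation for \<open>e\<^sub>t\<close>, read off coefficientwise: the integrand along an edge is the
  difference of \<open>z\<^bsup>(n+1)\<^esup> + z\<^bsup>(n)\<^esup> / 2\<close> at its end points.\<close>

lemma z_power_edge:
  assumes L: "rhombic_lattice \<Lambda>" and V: "0 \<in> vertices \<Lambda>" and e: "(a, b) \<in> edges \<Lambda>"
  shows "(z_power \<Lambda> n a + z_power \<Lambda> n b) / 2 * (b - a)
    = (z_power \<Lambda> (Suc n) b + z_power \<Lambda> n b / 2) - (z_power \<Lambda> (Suc n) a + z_power \<Lambda> n a / 2)"
proof -
  define d where "d = b - a"
  let ?F = "\<lambda>z. fps_expansion (\<lambda>t. e_fun \<Lambda> t z) 0"
  have nth: "fps_nth (?F z) k = z_power \<Lambda> k z" for z k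
    by (simp add: fps_expansion_def z_power_def)
  have F: "(\<lambda>t. e_fun \<Lambda> t z) has_fps_expansion ?F z" for z
    by (rule has_fps_expansion_fps_expansion[OF _ _ e_fun_holomorphic[OF L V]]) auto
  let ?f = "\<lambda>t. 2 * e_fun \<Lambda> t b + (1 - d) * (t * e_fun \<Lambda> t b)"
  let ?g = "\<lambda>t. 2 * e_fun \<Lambda> t a + (1 + d) * (t * e_fun \<Lambda> t a)"
  let ?B = "fps_const 2 * ?F b + fps_const (1 - d) * (fps_X * ?F b)"
  let ?A = "fps_const 2 * ?F a + fps_const (1 + d) * (fps_X * ?F a)"
  have fB: "?f has_fps_expansion ?B" and gA: "?g has_fps_expansion ?A"
    by (intro has_fps_expansion_add has_fps_expansion_mult has_fps_expansion_const
      has_fps_expansion_fps_X F)+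
  have "?f t = ?g t" if "norm t < 1" for t
    using e_fun_edge[OF L V that e] by (simp add: d_def algebra_simps)
  then have "\<forall>\<^sub>F t in nhds 0. ?f t = ?g t"
    by (intro eventually_nhds_in_open[of "ball 0 1", THEN eventually_mono]) auto
  then have "?f has_fps_expansion ?A \<longleftrightarrow> ?g has_fps_expansion ?A"
    by (intro has_fps_expansion_cong refl)
  then have "?f has_fps_expansion ?A" using gA by simp
  then have "?B = ?A" using fB fps_expansion_unique_complex by blast
  then have "fps_nth ?B (Suc n) = fps_nth ?A (Suc n)" by simp
  then have "2 * z_power \<Lambda> (Suc n) b + (1 - d) * z_power \<Lambda> n b
    = 2 * z_power \<Lambda> (Suc n) a + (1 + d) * z_power \<Lambda> n a"
    by (simp add: nth)
  then show ?thesis unfolding d_def[symmetric] by (simp add: field_simps)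
qed

section \<open>Discrete analytic functions and the shift operators\<close>

lemma path_integral_telescope:
  assumes "lattice_path \<Lambda> a b zs"
    and "\<And>x y. (x, y) \<in> edges \<Lambda> \<Longrightarrow> (f x + f y) / 2 * (y - x) = G y - G x"
  shows "path_integral f zs = G b - G a"
  unfolding path_integral_def
  by (rule lattice_path_telescope[OF assms(1), of "\<lambda>x y. (f x + f y) / 2 * (y - x)"]) (rule assms(2))

lemma DA_if_edge_differences:
  assumes "\<And>z. z \<notin> vertices \<Lambda> \<Longrightarrow> f z = 0"
    and "\<And>x y. (x, y) \<in> edges \<Lambda> \<Longrightarrow> (f x + f y) / 2 * (y - x) = G y - G x"
  shows "f \<in> DA \<Lambda>"
  using path_integral_telescope[of \<Lambda> _ _ _ f G] assms unfolding DA_def by auto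

lemma lattice_integral_if_edge_differences:
  assumes L: "rhombic_lattice \<Lambda>" and V: "a \<in> vertices \<Lambda>" "b \<in> vertices \<Lambda>"
    and G: "\<And>x y. (x, y) \<in> edges \<Lambda> \<Longrightarrow> (f x + f y) / 2 * (y - x) = G y - G x"
  shows "lattice_integral \<Lambda> a b f = G b - G a"
proof -
  have "lattice_path \<Lambda> a b (SOME zs. lattice_path \<Lambda> a b zs)"
    using lattice_connected[OF L V] someI[of "lattice_path \<Lambda> a b"] by blast
  then show ?thesis unfolding lattice_integral_def by (rule path_integral_telescope) (rule G)
qed

lemma z_power_DA:
  assumes "rhombic_lattice \<Lambda>" "0 \<in> vertices \<Lambda>"
  shows "z_power \<Lambda> n \<in> DA \<Lambda>"
  using z_power_outside z_power_edge[OF assms]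
  by (rule DA_if_edge_differences[where G = "\<lambda>z. z_power \<Lambda> (Suc n) z + z_power \<Lambda> n z / 2"])

lemma Z_plus_z_power:
  assumes L: "rhombic_lattice \<Lambda>" and V: "0 \<in> vertices \<Lambda>"
  shows "Z_plus \<Lambda> (z_power \<Lambda> n) = z_power \<Lambda> (Suc n)"
proof
  fix z
  show "Z_plus \<Lambda> (z_power \<Lambda> n) z = z_power \<Lambda> (Suc n) z"
  proof (cases "z \<in> vertices \<Lambda>")
    case True
    have "lattice_integral \<Lambda> 0 z (z_power \<Lambda> n)
      = (z_power \<Lambda> (Suc n) z + z_power \<Lambda> n z / 2) - (z_power \<Lambda> (Suc n) 0 + z_power \<Lambda> n 0 / 2)"
      by (rule lattice_integral_if_edge_differences[OF L V True z_power_edge[OF L V]])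
    then show ?thesis
      using True z_power_zero[OF V, of "Suc n"]
      by (simp add: Z_plus_def add_divide_distrib diff_divide_distrib)
  qed (simp add: Z_plus_def z_power_outside)
qed

lemma z_power_1:
  assumes L: "rhombic_lattice \<Lambda>" and V: "0 \<in> vertices \<Lambda>" and z: "z \<in> vertices \<Lambda>"
  shows "z_power \<Lambda> 1 z = z"
proof -
  have "lattice_integral \<Lambda> 0 z (z_power \<Lambda> 0) = z - 0"
    using z_power_0 edges_vertices
    by (intro lattice_integral_if_edge_differences[OF L V z, where G = "\<lambda>z. z"]) auto
  then show ?thesis
    using Z_plus_z_power[OF L V, of 0] z V z_power_0 by (auto simp: Z_plus_def fun_eq_iff split: if_splits)
qed

lemma lattice_path_append:
  assumes "lattice_path \<Lambda> a b zs" "lattice_path \<Lambda> b c ws"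
  shows "lattice_path \<Lambda> a c (zs @ tl ws) \<and> path_integral f (zs @ tl ws) = path_integral f zs + path_integral f ws"
  using assms(2)
proof (induction ws arbitrary: c rule: rev_induct)
  case Nil
  then show ?case by (simp add: lattice_path_def)
next
  case (snoc x ws)
  show ?case
  proof (cases "ws = []")
    case True
    then have "c = b" using snoc.prems by (auto simp: lattice_path_def)
    then show ?thesis using True assms(1) by (simp add: path_integral_def)
  next
    case False
    note p = lattice_path_snocD[OF snoc.prems False]
    note IH = snoc.IH[OF p(1)]
    have ne: "zs @ tl ws \<noteq> []" using assms(1) by (simp add: lattice_path_def)
    have la: "last (zs @ tl ws) = last ws" using IH by (simp add: lattice_path_def)
    have eq: "zs @ tl (ws @ [x]) = (zs @ tl ws) @ [x]" using False by simp
    note snoc_integral = sum_steps_snoc[of _ "\<lambda>x y. (f x + f y) / 2 * (y - x)" x, folded path_integral_def]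
    have "lattice_path \<Lambda> a c ((zs @ tl ws) @ [x])"
      using lattice_path_snoc[OF conjunct1[OF IH] p(2)] p(3) by simp
    moreover have "path_integral f ((zs @ tl ws) @ [x]) = path_integral f zs + path_integral f (ws @ [x])"
      using snoc_integral[OF ne] snoc_integral[OF False] la IH by simp
    ultimately show ?thesis unfolding eq by blast
  qed
qed

text \<open>Any two paths from \<open>c\<close> to \<open>b\<close> are closed up by one fixed return path, so no reversal of
  paths is involved.\<close>

lemma lattice_integral_edge:
  assumes L: "rhombic_lattice \<Lambda>" and f: "f \<in> DA \<Lambda>" and c: "c \<in> vertices \<Lambda>" and e: "(a, b) \<in> edges \<Lambda>"
  shows "lattice_integral \<Lambda> c b f - lattice_integral \<Lambda> c a f = (f a + f b) / 2 * (b - a)"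
proof -
  note V = edges_vertices[OF e]
  let ?p = "\<lambda>z. SOME zs. lattice_path \<Lambda> c z zs"
  have p: "lattice_path \<Lambda> c z (?p z)" if "z \<in> vertices \<Lambda>" for z
    using lattice_connected[OF L c that] someI[of "lattice_path \<Lambda> c z"] by blast
  obtain w where w: "lattice_path \<Lambda> b c w" using lattice_connected[OF L V(2) c] .
  have closed: "path_integral f zs = - path_integral f w" if "lattice_path \<Lambda> c b zs" for zs
  proof -
    have "path_integral f (zs @ tl w) = 0"
      using f lattice_path_append[OF that w] unfolding DA_def by blast
    then show ?thesis using lattice_path_append[OF that w, of f] by (simp add: eq_neg_iff_add_eq_0)
  qed
  have pa: "?p a \<noteq> []" "last (?p a) = a" using p[OF V(1)] unfolding lattice_path_def by auto
  have "path_integral f (?p b) = path_integral f (?p a @ [b])"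
    using closed[OF p[OF V(2)]] closed[OF lattice_path_snoc[OF p[OF V(1)] e]] by simp
  also have "\<dots> = path_integral f (?p a) + (f a + f b) / 2 * (b - a)"
    using sum_steps_snoc[OF pa(1), of "\<lambda>x y. (f x + f y) / 2 * (y - x)" b, folded path_integral_def] pa(2)
    by simp
  finally show ?thesis by (simp add: lattice_integral_def)
qed

text \<open>If \<open>Z\<^sub>+ f = 0\<close>, comparing two adjacent vertices gives \<open>(1 - d) f b = (1 + d) f a\<close> with \<open>d = b - a\<close>:
  an edge with \<open>d = 1\<close> forces \<open>f a = 0\<close>, and the zero propagates backwards through all edges with
  \<open>d \<noteq> \<plusminus>1\<close>.\<close>

lemma Z_plus_injective:
  assumes L: "rhombic_lattice \<Lambda>" and V: "0 \<in> vertices \<Lambda>" and one: "path_to_one_step \<Lambda>"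
    and f: "f \<in> DA \<Lambda>" and zero: "\<And>z. z \<in> vertices \<Lambda> \<Longrightarrow> Z_plus \<Lambda> f z = 0"
  shows "f = (\<lambda>z. 0)"
proof
  have step: "(1 - (b - a)) * f b = (1 + (b - a)) * f a" if e: "(a, b) \<in> edges \<Lambda>" for a b
  proof -
    have "Z_plus \<Lambda> f b - Z_plus \<Lambda> f a = 0" using zero edges_vertices[OF e] by simp
    then have "(f a - f b) / 2 + (f a + f b) / 2 * (b - a) = 0"
      unfolding lattice_integral_edge[OF L f V e, symmetric]
      using edges_vertices[OF e]
      by (simp add: Z_plus_def add_divide_distrib diff_divide_distrib algebra_simps)
    moreover have "(1 + (b - a)) * f a - (1 - (b - a)) * f b
      = 2 * ((f a - f b) / 2 + (f a + f b) / 2 * (b - a))"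
      by (simp add: field_simps)
    ultimately show ?thesis by (metis eq_iff_diff_eq_0 mult_zero_right)
  qed
  fix z
  show "f z = 0"
  proof (cases "z \<in> vertices \<Lambda>")
    case False
    then show ?thesis using f unfolding DA_def by blast
  next
    case True
    then obtain zs w where p: "lattice_path \<Lambda> z w zs" and len: "length zs \<ge> 2"
      and gen: "\<And>n. n \<in> {1..<length zs - 1} \<Longrightarrow> zs ! n - zs ! (n - 1) \<notin> {1, -1}"
      and last: "zs ! (length zs - 1) - zs ! (length zs - 2) = 1"
      using one unfolding path_to_one_step_def by blast
    have e: "(zs ! (n - 1), zs ! n) \<in> edges \<Lambda>" if "n \<in> {1..<length zs}" for n
      using p that unfolding lattice_path_def by blast
    have "f (zs ! (length zs - 2 - k)) = 0" if "k \<le> length zs - 2" for k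
      using that
    proof (induction k)
      case 0
      have "length zs - 1 - 1 = length zs - 2" "length zs - 1 \<in> {1..<length zs}" using len by auto
      then show ?case using step[OF e[of "length zs - 1"]] last by simp
    next
      case (Suc k)
      let ?n = "length zs - 2 - k"
      have n: "?n \<in> {1..<length zs - 1}" "?n \<in> {1..<length zs}" "length zs - 2 - Suc k = ?n - 1"
        using Suc.prems len by auto
      have "1 + (zs ! ?n - zs ! (?n - 1)) \<noteq> 0"
        using gen[OF n(1)] by (simp add: eq_neg_iff_add_eq_0 add.commute)
      then show ?case using step[OF e[OF n(2)]] Suc.IH Suc.prems n(3) by simp
    qed
    from this[of "length zs - 2"] have "f (zs ! 0) = 0" by simp
    then show ?thesis using p by (metis lattice_path_def hd_conv_nth)
  qed
qed

lemma path_integral_sum: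
  "path_integral (\<lambda>z. \<Sum>i\<in>I. c i * f i z) zs = (\<Sum>i\<in>I. c i * path_integral (f i) zs)"
proof -
  have "((\<Sum>i\<in>I. c i * f i x) + (\<Sum>i\<in>I. c i * f i y)) / 2 * (y - x)
    = (\<Sum>i\<in>I. c i * ((f i x + f i y) / 2 * (y - x)))" for x y
    by (simp only: sum.distrib[symmetric] sum_divide_distrib sum_distrib_right)
      (rule sum.cong, simp_all add: field_simps)
  then show ?thesis
    unfolding path_integral_def by (simp add: sum_distrib_left) (rule sum.swap)
qed

lemma DA_sum:
  assumes "\<And>i. i \<in> I \<Longrightarrow> f i \<in> DA \<Lambda>"
  shows "(\<lambda>z. \<Sum>i\<in>I. c i * f i z) \<in> DA \<Lambda>"
  using assms unfolding DA_def by (auto simp: path_integral_sum)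

lemma Z_plus_sum:
  "Z_plus \<Lambda> (\<lambda>z. \<Sum>i\<in>I. c i * f i z) z = (\<Sum>i\<in>I. c i * Z_plus \<Lambda> (f i) z)"
  unfolding Z_plus_def lattice_integral_def path_integral_sum
  by (simp add: sum_subtractf[symmetric] sum_divide_distrib sum.distrib[symmetric] algebra_simps diff_divide_distrib)

lemma Z_minus_eqI:
  assumes L: "rhombic_lattice \<Lambda>" and V: "0 \<in> vertices \<Lambda>" and one: "path_to_one_step \<Lambda>"
    and g: "g \<in> DA \<Lambda>" "\<And>z. z \<in> vertices \<Lambda> \<Longrightarrow> Z_plus \<Lambda> g z = f z - f 0"
  shows "Z_minus \<Lambda> f = g"
  unfolding Z_minus_def
proof (rule the_equality)
  show "g \<in> DA \<Lambda> \<and> (\<forall>z\<in>vertices \<Lambda>. Z_plus \<Lambda> g z = f z - f 0)" using g by blast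
next
  fix h assume h: "h \<in> DA \<Lambda> \<and> (\<forall>z\<in>vertices \<Lambda>. Z_plus \<Lambda> h z = f z - f 0)"
  \<comment> \<open>The difference \<open>h - g\<close>, written as a linear combination indexed by the Booleans.\<close>
  define F where "F i = (if i then h else g)" for i
  define c where "c i = (if i then 1 else -1 :: complex)" for i
  let ?D = "\<lambda>z. \<Sum>i\<in>UNIV. c i * F i z"
  have "?D \<in> DA \<Lambda>" by (rule DA_sum) (use h g(1) in \<open>auto simp: F_def\<close>)
  moreover have "Z_plus \<Lambda> ?D z = 0" if "z \<in> vertices \<Lambda>" for z
    unfolding Z_plus_sum using h g(2) that by (simp add: UNIV_bool F_def c_def)
  ultimately have "?D = (\<lambda>z. 0)" by (rule Z_plus_injective[OF L V one])
  then show "h = g" by (simp add: UNIV_bool F_def c_def fun_eq_iff)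
qed

section \<open>Linear independence and growth\<close>

text \<open>Evaluation at \<open>0\<close> kills the constant coefficient of a relation, and injectivity of \<open>Z\<^sub>+\<close> lowers
  all the remaining indices by one.\<close>

lemma z_power_relation_trivial:
  assumes L: "rhombic_lattice \<Lambda>" and V: "0 \<in> vertices \<Lambda>" and one: "path_to_one_step \<Lambda>"
    and rel: "\<And>z. (\<Sum>n<N. c n * z_power \<Lambda> n z) = 0" and n: "n < N"
  shows "c n = 0"
  using rel n
proof (induction N arbitrary: c n)
  case 0
  then show ?case by simp
next
  case (Suc N)
  have rel: "c 0 * z_power \<Lambda> 0 z + (\<Sum>n<N. c (Suc n) * z_power \<Lambda> (Suc n) z) = 0" for z
    using Suc.prems(1)[of z] by (simp only: sum.lessThan_Suc_shift)
  have c0: "c 0 = 0" using rel[of 0] by (simp add: z_power_zero[OF V])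
  let ?f = "\<lambda>z. \<Sum>n<N. c (Suc n) * z_power \<Lambda> n z"
  have "?f \<in> DA \<Lambda>" by (rule DA_sum) (rule z_power_DA[OF L V])
  moreover have "Z_plus \<Lambda> ?f z = 0" for z
    using rel[of z] by (simp add: Z_plus_sum Z_plus_z_power[OF L V] c0)
  ultimately have "?f = (\<lambda>z. 0)" using Z_plus_injective[OF L V one] by blast
  then have "c (Suc k) = 0" if "k < N" for k
    using Suc.IH[of "\<lambda>n. c (Suc n)", OF _ that] by (simp add: fun_eq_iff)
  then show ?case using c0 Suc.prems(2) by (cases n) auto
qed

lemma z_power_independent:
  assumes L: "rhombic_lattice \<Lambda>" and V: "0 \<in> vertices \<Lambda>" and one: "path_to_one_step \<Lambda>"
  shows "independent_family (z_power \<Lambda>)"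
proof -
  note triv = z_power_relation_trivial[OF L V one]
  have inj: "inj (z_power \<Lambda>)"
  proof (rule injI, rule ccontr)
    fix m n assume eq: "z_power \<Lambda> m = z_power \<Lambda> n" and ne: "m \<noteq> n"
    define c where "c k = (if k = m then 1 else 0) - (if k = n then 1 else 0 :: complex)" for k
    have ck: "c k * z_power \<Lambda> k z
      = (if k = m then z_power \<Lambda> m z else 0) - (if k = n then z_power \<Lambda> n z else 0)" for k z
      by (simp add: c_def)
    have "(\<Sum>k<Suc (max m n). c k * z_power \<Lambda> k z) = 0" for z
      unfolding ck sum_subtractf using eq by (simp add: sum.delta less_Suc_eq_le del: sum.lessThan_Suc)
    from triv[where N = "Suc (max m n)" and c = c and n = m, OF this] show False using ne by (simp add: c_def less_Suc_eq_le)
  qed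
  have "cfun.independent (range (z_power \<Lambda>))"
    unfolding cfun.independent_explicit_finite_subsets
  proof (intro allI impI ballI)
    fix S u v
    assume S: "S \<subseteq> range (z_power \<Lambda>)" "finite S" and v: "v \<in> S"
      and rel: "(\<Sum>v\<in>S. (\<lambda>z. u v * v z)) = 0"
    obtain I where I: "finite I" "S = z_power \<Lambda> ` I" using finite_subset_image[OF S(2,1)] by blast
    obtain N where N: "I \<subseteq> {..<N}" using finite_nat_bounded[OF I(1)] by blast
    define c where "c n = (if n \<in> I then u (z_power \<Lambda> n) else 0)" for n
    have "(\<Sum>n<N. c n * z_power \<Lambda> n z) = 0" for z
    proof -
      have "(\<Sum>n<N. c n * z_power \<Lambda> n z) = (\<Sum>n\<in>I. u (z_power \<Lambda> n) * z_power \<Lambda> n z)"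
        by (rule sum.mono_neutral_cong_right) (use N in \<open>auto simp: c_def\<close>)
      also have "\<dots> = (\<Sum>v\<in>S. u v * v z)"
        unfolding I(2) by (subst sum.reindex) (use inj in \<open>auto simp: inj_on_def\<close>)
      also have "\<dots> = (\<Sum>v\<in>S. (\<lambda>z. u v * v z)) z"
        using S(2) by (induction S) auto
      finally show ?thesis by (simp add: rel)
    qed
    note c = triv[where N = N and c = c, OF this]
    obtain n where n: "n \<in> I" "v = z_power \<Lambda> n" using v I(2) by blast
    then have "n < N" using N by blast
    then show "u v = 0" using c[of n] n by (simp add: c_def)
  qed
  then show ?thesis using inj by (simp add: independent_family_def)
qed

lemma z_power_limsup:
  assumes L: "rhombic_lattice \<Lambda>" and V: "0 \<in> vertices \<Lambda>"
  shows "limsup (\<lambda>n. ereal (root n (norm (z_power \<Lambda> n z)))) \<le> 1"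
proof -
  let ?a = "\<lambda>n. z_power \<Lambda> n z"
  have "ereal r \<le> conv_radius ?a" if "0 < r" "r < 1" for r
  proof -
    have "norm (of_real r :: complex) < 1" using that by simp
    then have "summable (\<lambda>n. of_real r ^ n * ?a n)"
      using z_power_sums[OF L V] sums_summable by blast
    then have "summable (\<lambda>n. ?a n * of_real r ^ n)" by (simp add: mult.commute)
    then have "ereal (norm (of_real r :: complex)) \<le> conv_radius ?a" by (rule conv_radius_geI)
    then show ?thesis using that by simp
  qed
  note pos = this
  have "w \<le> conv_radius ?a" if "w < 1" for w
  proof (cases "w \<le> 0")
    case True
    then show ?thesis using conv_radius_nonneg order_trans by blast
  next
    case False
    then show ?thesis using that pos by (cases w) auto
  qed
  then have "1 \<le> conv_radius ?a" by (rule dense_le)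
  moreover have "0 \<le> limsup (\<lambda>n. ereal (root n (norm (?a n))))"
    by (intro le_Limsup always_eventually) (auto simp: real_root_ge_zero)
  ultimately show ?thesis
    unfolding conv_radius_def
    by (cases "limsup (\<lambda>n. ereal (root n (norm (?a n))))") (auto simp: one_ereal_def one_le_inverse_iff split: if_splits)
qed

section \<open>Properties of the Taylor coefficients\<close>

theorem proposition4p3:
  fixes \<Lambda> :: "complex set set"
  assumes "rhombic_lattice \<Lambda>"
    and "0 \<in> vertices \<Lambda>"
    and "path_to_one_step \<Lambda>"
    and "\<forall>t\<in>S_set \<Lambda>. \<not> eigenvalue_Z_minus \<Lambda> t"
  shows "(\<forall>z\<in>vertices \<Lambda>. \<forall>t. norm t < 1 \<longrightarrow> (\<lambda>n. t ^ n * z_power \<Lambda> n z) sums e_fun \<Lambda> t z) \<and>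
    (\<forall>n. z_power \<Lambda> n \<in> DA \<Lambda>) \<and>
    (\<forall>z\<in>vertices \<Lambda>. z_power \<Lambda> 0 z = 1) \<and>
    (\<forall>n\<ge>1. z_power \<Lambda> n = Z_plus \<Lambda> (z_power \<Lambda> (n - 1))) \<and>
    (\<forall>z\<in>vertices \<Lambda>. z_power \<Lambda> 1 z = z) \<and>
    Z_minus \<Lambda> (z_power \<Lambda> 0) = (\<lambda>z. 0) \<and>
    (\<forall>n\<ge>1. Z_minus \<Lambda> (z_power \<Lambda> n) = z_power \<Lambda> (n - 1)) \<and>
    (\<forall>z\<in>vertices \<Lambda>. limsup (\<lambda>n. ereal (root n (norm (z_power \<Lambda> n z)))) \<le> 1) \<and>
    independent_family (z_power \<Lambda>)"
proof -
  note L = assms(1) and V = assms(2) and one = assms(3)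
  note step = Z_plus_z_power[OF L V]
  have pred: "z_power \<Lambda> n = Z_plus \<Lambda> (z_power \<Lambda> (n - 1))" if "n \<ge> 1" for n
    using step[of "n - 1"] that by simp
  have "Z_minus \<Lambda> (z_power \<Lambda> 0) = (\<lambda>z. 0)"
  proof (rule Z_minus_eqI[OF L V one])
    show "(\<lambda>z. 0) \<in> DA \<Lambda>" using DA_sum[of "{}"] by simp
    show "Z_plus \<Lambda> (\<lambda>z. 0) z = z_power \<Lambda> 0 z - z_power \<Lambda> 0 0" if "z \<in> vertices \<Lambda>" for z
      using Z_plus_sum[of \<Lambda> _ _ "{}"] z_power_0[OF that] z_power_0[OF V] by simp
  qed
  moreover have "Z_minus \<Lambda> (z_power \<Lambda> n) = z_power \<Lambda> (n - 1)" if "n \<ge> 1" for n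
  proof (rule Z_minus_eqI[OF L V one z_power_DA[OF L V]])
    show "Z_plus \<Lambda> (z_power \<Lambda> (n - 1)) z = z_power \<Lambda> n z - z_power \<Lambda> n 0" for z
      unfolding pred[OF that, symmetric] using that by (simp add: z_power_zero[OF V])
  qed
  ultimately show ?thesis
    using z_power_sums[OF L V] z_power_DA[OF L V] z_power_0 pred z_power_1[OF L V]
      z_power_limsup[OF L V] z_power_independent[OF L V one] by blast
qed

end
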